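(* Assume that the kernel $K$ satisfies Assumptions A1–A4 stated in the context. Let $\beta>0$. On $\mathbb{R}\times[0,2\pi]$, the ODE system $$\left\{\begin{aligned} \tilde R' &= 2(K'(0)-K'(-\tilde\theta))\tilde R^2+2(K'(\tilde\theta)-K'(0))\tilde R,\\ \tilde\theta' &= 2(K(0)-K(-\tilde\theta))\tilde R+2(K(\tilde\theta)-K(0)) \end{aligned}\right.$$ for $(\tilde R,\tilde\theta)$ has the following equilibrium points, depending on the value of $\beta>0$: - $(1,\pi)$, an attractor if $0<\beta<\beta^*$; a saddle point if $\beta>\beta^*$. - $(\bar R,\bar\theta)$ and $(1/\bar R,2\pi-\bar\theta)$, a pair of saddle points, for $0<\beta<\beta^*$. - $(0,2\pi)$, an attractor, for all $\beta>0$. - $(0,\theta_3)$, a repeller, for $0<\beta<\beta_3$. - $(0,\theta_2)$, a saddle point, for $0<\beta<\beta_2$. - $(0,\theta_1)$, a repeller, for $0<\beta<\beta_0$. - $(0,0)$, a saddle if $\beta\in(0,\beta_0)\cup(\beta_2,\beta_3)$; a repeller if $\beta\in(\beta_0,\beta_2)\cup(\beta_3,\infty)$. - $(-1,0)$ and $(-1,2\pi)$, saddle points, for all $\beta>0$.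
   Context: **Kernel.** For real $\beta\ne0$, $K=K_\beta:\mathbb{R}\to\mathbb{R}$ is the $2\pi$-periodic (continuous) function given by $$K(\theta)=\frac14\operatorname{Re}\left[\frac{e^{\frac{2(\beta-i)}{1+\beta^2}(\theta-\pi)}}{\sin\left(\frac{2\pi(1+i\beta)}{1+\beta^2}\right)}\right],\qquad 0\le\theta\le2\pi .$$ $K',K''$ are its derivatives away from $2\pi\mathbb{Z}$ (so $K(-\theta)=K(2\pi-\theta)$, $K'(-\theta)=K'(2\pi-\theta)$, $K''(-\theta)=K''(2\pi-\theta)$ for $0<\theta<2\pi$). Put $K'(+0)=\lim_{\theta\to0+}K'(\theta)$, $K'(-0)=\lim_{\theta\to0-}K'(\theta)$, and define $K'(0)=\frac{K'(+0)+K'(-0)}2$. **System on the boundary.** The symbol $K'(0)$ in the coefficients is always the average just defined. On the boundary $\tilde\theta\in\{0,2\pi\}$, $K'(\tilde\theta)$ and $K'(-\tilde\theta)$ are one-sided limits from inside: they equal $K'(+0)$ and $K'(-0)$ at $\tilde\theta=0$, and $K'(-0)$ and $K'(+0)$ at $\tilde\theta=2\pi$, respectively (similarly for $K''$). With this convention the vector field is smooth up to the boundary. **Types of equilibria.** An equilibrium is an attractor (repeller) if both eigenvalues of the Jacobian matrix of the vector field there (one-sided derivatives in $\tilde\theta$ on the boundary) have negative (positive) real part, and a saddle point if the eigenvalues are real, one positive and one negative. **Constants $\beta_0,\beta_2,\beta_3$ and angles $\theta_i$.** $0<\beta_0<\beta_2<\beta_3$ are the constants such that, for $\beta>0$, the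 number of solutions of $K(\theta)=K(0)$ in $(0,2\pi)$ is $3$ if $\beta\in(0,\beta_0)$, $2$ if $\beta\in[\beta_0,\beta_2)$, $1$ if $\beta\in[\beta_2,\beta_3)$, and $0$ if $\beta\in[\beta_3,\infty)$. The solutions are denoted $\theta_1<\theta_2<\theta_3$ if $\beta\in(0,\beta_0)$; $\theta_2<\theta_3$ if $\beta\in[\beta_0,\beta_2)$; $\theta_3$ if $\beta\in[\beta_2,\beta_3)$. **Function $F$.** $F(\theta)=K(0)(K'(-\theta)-K'(\theta))+K(\theta)(K'(0)-K'(-\theta))+K(-\theta)(K'(\theta)-K'(0))$. **Assumptions (supported numerically in the paper and taken as standing hypotheses).** A1. $\theta_1,\theta_2,\theta_3$ are decreasing functions of $\beta>0$ (on their ranges of definition). Also $\theta_2+\theta_3>2\pi$ when $\beta=\beta_0$; thus there is a unique $\beta_1\in(\beta_0,\beta_2)$ such that $\theta_2+\theta_3=2\pi$ when $\beta=\beta_1$. Moreover $\theta_3>\pi$ when $\beta=\beta_2$. Consequently: if $\beta\in(0,\beta_0)$, $0<\theta_1<2\pi-\theta_3<\theta_2<2\pi-\theta_2<\theta_3<2\pi-\theta_1<2\pi$; if $\beta\in(\beta_0,\beta_1)$, $0<2\pi-\theta_3<\theta_2<2\pi-\theta_2<\theta_3<2\pi$; if $\beta\in(\beta_1,\beta_2)$, $0<\theta_2<2\pi-\theta_3<\theta_3<2\pi-\theta_2<2\pi$; if $\beta\in(\beta_2,1)$, $0<2\pi-\theta_3<\theta_3<2\pi$; if $\beta\in(1,\beta_3)$,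 $0<\theta_3<2\pi-\theta_3<2\pi$. A2. For each $\beta>0$ there is a unique $\alpha\in(\pi,2\pi)$ such that $K'(\theta)>K'(0)$ for $\theta\in(0,\alpha)$, $K'(\alpha)=K'(0)$, and $K'(\theta)<K'(0)$ for $\theta\in(\alpha,2\pi)$. Consequently $K''(\alpha)<0$. A3. There is a unique $\beta^*>0$ for which $F'(\pi)=2K'(\pi)(K'(0)-K'(\pi))-2K''(\pi)(K(0)-K(\pi))$ equals zero; $F'(\pi)>0$ if $0<\beta<\beta^*$ and $F'(\pi)<0$ if $\beta>\beta^*$. Consequently, when $0<\beta<\beta^*$ there is a unique $\bar\theta\in(0,\pi)$ with $F(\bar\theta)=0$ (and then $F'(\bar\theta)<0$); if $\beta>\beta^*$ there is no such $\bar\theta$. Moreover $\beta^*\in(\beta_1,\beta_2)$. A4. For all $0<\beta<\beta_1$ and $\theta,\eta\in(\theta_2,2\pi-\theta_2)$, $$\left|\frac{K''(\theta)}{K'(\theta)-K'(0)}+\frac{K''(-\theta)}{K'(-\theta)-K'(0)}\right|<\frac{K'(\eta)}{K(\eta)-K(0)}+\frac{K'(-\eta)}{K(-\eta)-K(0)},$$ and for all $\beta_1<\beta<\beta^*$ and $\theta\in(\bar\theta,2\pi-\bar\theta)$, $$\frac{K''(\theta)}{K'(\theta)-K'(0)}+\frac{K''(-\theta)}{K'(-\theta)-K'(0)}>0 .$$ **Definition of $\bar R$.** For $0<\beta<\beta^*$, $\bar\theta$ is as in A3 and $\bar R=\dfrac{K'(\bar\theta)-K'(0)}{K'(-\bar\theta)-K'(0)}$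 (which equals $\dfrac{K(\bar\theta)-K(0)}{K(-\bar\theta)-K(0)}$ whenever the latter is defined). *)

theory Defs
  imports
    "HOL-Analysis.Analysis"
    "HOL-Library.Real_Mod"
    "Jordan_Normal_Form.Spectral_Radius"
begin

section \<open>The kernel\<close>

definition kernel :: "real \<Rightarrow> real \<Rightarrow> real" where
  "kernel \<beta> \<theta> =
     1 / 4 * Re (exp (2 * (complex_of_real \<beta> - \<i>) / (1 + complex_of_real \<beta> ^ 2)
                       * complex_of_real (\<theta> rmod (2 * pi) - pi))
                 / sin (2 * complex_of_real pi * (1 + \<i> * complex_of_real \<beta>)
                       / (1 + complex_of_real \<beta> ^ 2)))"

text \<open>The first two derivatives of the kernel; they are meaningful only away from the integer
  multiples of \<open>2\<pi>\<close>.\<close>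

definition kernel' :: "real \<Rightarrow> real \<Rightarrow> real" where
  "kernel' \<beta> \<theta> = deriv (kernel \<beta>) \<theta>"

definition kernel'' :: "real \<Rightarrow> real \<Rightarrow> real" where
  "kernel'' \<beta> \<theta> = deriv (kernel' \<beta>) \<theta>"

definition kernel'_plus :: "real \<Rightarrow> real" where
  "kernel'_plus \<beta> = Lim (at_right 0) (kernel' \<beta>)"

definition kernel'_minus :: "real \<Rightarrow> real" where
  "kernel'_minus \<beta> = Lim (at_left 0) (kernel' \<beta>)"

text \<open>The value written \<open>K'(0)\<close> in the source. It is not \<open>kernel' \<beta> 0\<close>: the kernel has a corner
  at \<open>0\<close>.\<close>

definition kernel'_zero :: "real \<Rightarrow> real" where
  "kernel'_zero \<beta> = (kernel'_plus \<beta> + kernel'_minus \<beta>) / 2"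

text \<open>\<open>K'(\<theta>)\<close> and \<open>K'(-\<theta>)\<close> for \<open>0 \<le> \<theta> \<le> 2\<pi>\<close> as used in the vector field, where the values on
  the boundary are the limits from inside the interval.\<close>

definition kernel'_pos :: "real \<Rightarrow> real \<Rightarrow> real" where
  "kernel'_pos \<beta> \<theta> =
     (if \<theta> = 0 then kernel'_plus \<beta> else if \<theta> = 2 * pi then kernel'_minus \<beta> else kernel' \<beta> \<theta>)"

definition kernel'_neg :: "real \<Rightarrow> real \<Rightarrow> real" where
  "kernel'_neg \<beta> \<theta> =
     (if \<theta> = 0 then kernel'_minus \<beta> else if \<theta> = 2 * pi then kernel'_plus \<beta> else kernel' \<beta> (- \<theta>))"

lemma kernel_periodic: "kernel \<beta> (\<theta> + 2 * pi) = kernel \<beta> \<theta>"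
proof -
  have "(\<theta> + 2 * pi) rmod (2 * pi) = \<theta> rmod (2 * pi)"
    by (simp add: rmod_def add_divide_distrib algebra_simps)
  thus ?thesis by (simp add: kernel_def)
qed

text \<open>The reduction modulo \<open>2\<pi>\<close> takes values in \<open>[0, 2\<pi>)\<close>; the defining formula nevertheless
  holds on the closed interval.\<close>

lemma kernel_eq:
  assumes "\<beta> \<noteq> 0" "0 \<le> \<theta>" "\<theta> \<le> 2 * pi"
  shows "kernel \<beta> \<theta> =
     1 / 4 * Re (exp (2 * (complex_of_real \<beta> - \<i>) / (1 + complex_of_real \<beta> ^ 2)
                       * complex_of_real (\<theta> - pi))
                 / sin (2 * complex_of_real pi * (1 + \<i> * complex_of_real \<beta>)
                       / (1 + complex_of_real \<beta> ^ 2)))"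
proof (cases "\<theta> = 2 * pi")
  case False
  with assms have "\<theta> rmod (2 * pi) = \<theta>"
    by (intro rmod_unique[where n = 0]) auto
  thus ?thesis by (simp add: kernel_def)
next
  case True
  define c where "c = 2 * (complex_of_real \<beta> - \<i>) / (1 + complex_of_real \<beta> ^ 2)"
  define z where "z = 2 * complex_of_real pi * (1 + \<i> * complex_of_real \<beta>)
                       / (1 + complex_of_real \<beta> ^ 2)"
  have z: "z = \<i> * (c * complex_of_real pi)"
    by (simp add: z_def c_def algebra_simps)
  have iz: "\<i> * z = - (c * complex_of_real pi)"
    by (simp add: z flip: mult.assoc)
  have "1 + complex_of_real \<beta> ^ 2 = complex_of_real (1 + \<beta> ^ 2)"
    by simp
  hence "z = complex_of_real (2 * pi / (1 + \<beta> ^ 2)) * (1 + \<i> * complex_of_real \<beta>)"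
    unfolding z_def by (simp add: field_simps)
  hence "Im z = 2 * pi / (1 + \<beta> ^ 2) * \<beta>"
    by simp
  moreover have "1 + \<beta> ^ 2 \<noteq> 0"
    by (smt (verit) zero_le_power2)
  ultimately have "Im z \<noteq> 0"
    using assms(1) by simp
  hence s: "sin z \<noteq> 0"
    by (auto simp: sin_eq_0)
  have "exp (c * complex_of_real pi) - exp (- (c * complex_of_real pi)) = - 2 * \<i> * sin z"
    by (simp add: sin_exp_eq iz field_simps)
  hence "exp (c * complex_of_real pi) / sin z - exp (- (c * complex_of_real pi)) / sin z = - 2 * \<i>"
    using s by (simp add: field_simps)
  from arg_cong[OF this, of Re]
  have "Re (exp (c * complex_of_real pi) / sin z) = Re (exp (- (c * complex_of_real pi)) / sin z)"
    by simp
  moreover have "(2 * pi) rmod (2 * pi) = 0"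
    by (rule rmod_unique[where n = 1]) auto
  ultimately show ?thesis
    unfolding kernel_def True c_def [symmetric] z_def [symmetric] by simp
qed


section \<open>The system and its equilibria\<close>

definition phase_space :: "(real \<times> real) set" where
  "phase_space = UNIV \<times> {0..2 * pi}"

definition vec_field :: "real \<Rightarrow> real \<times> real \<Rightarrow> real \<times> real" where
  "vec_field \<beta> = (\<lambda>(R, \<theta>).
     (2 * (kernel'_zero \<beta> - kernel'_neg \<beta> \<theta>) * R ^ 2
        + 2 * (kernel'_pos \<beta> \<theta> - kernel'_zero \<beta>) * R,
      2 * (kernel \<beta> 0 - kernel \<beta> (- \<theta>)) * R
        + 2 * (kernel \<beta> \<theta> - kernel \<beta> 0)))"

definition equilibrium :: "real \<Rightarrow> real \<times> real \<Rightarrow> bool" where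
  "equilibrium \<beta> p \<longleftrightarrow> p \<in> phase_space \<and> vec_field \<beta> p = (0, 0)"

text \<open>Differentiation is relative to the strip, hence one-sided in \<open>\<theta>\<close> on the boundary; the
  matrix is unique there.\<close>

definition jacobian_at :: "real \<Rightarrow> real \<times> real \<Rightarrow> real mat \<Rightarrow> bool" where
  "jacobian_at \<beta> p A \<longleftrightarrow> A \<in> carrier_mat 2 2 \<and>
     (vec_field \<beta> has_derivative
        (\<lambda>h. (A $$ (0, 0) * fst h + A $$ (0, 1) * snd h,
              A $$ (1, 0) * fst h + A $$ (1, 1) * snd h))) (at p within phase_space)"

definition attractor :: "real \<Rightarrow> real \<times> real \<Rightarrow> bool" where
  "attractor \<beta> p \<longleftrightarrow> equilibrium \<beta> p \<and>
     (\<exists>A. jacobian_at \<beta> p A \<and> (\<forall>z \<in> spectrum (map_mat complex_of_real A). Re z < 0))"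

definition repeller :: "real \<Rightarrow> real \<times> real \<Rightarrow> bool" where
  "repeller \<beta> p \<longleftrightarrow> equilibrium \<beta> p \<and>
     (\<exists>A. jacobian_at \<beta> p A \<and> (\<forall>z \<in> spectrum (map_mat complex_of_real A). Re z > 0))"

definition saddle :: "real \<Rightarrow> real \<times> real \<Rightarrow> bool" where
  "saddle \<beta> p \<longleftrightarrow> equilibrium \<beta> p \<and>
     (\<exists>A. jacobian_at \<beta> p A \<and>
        (\<exists>a b. a < 0 \<and> 0 < b \<and>
           spectrum (map_mat complex_of_real A) = {complex_of_real a, complex_of_real b}))"


section \<open>Constants, angles and standing assumptions\<close>

definition level_set :: "real \<Rightarrow> real set" where
  "level_set \<beta> = {\<theta> \<in> {0<..<2 * pi}. kernel \<beta> \<theta> = kernel \<beta> 0}"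

text \<open>The angles are functions of \<open>\<beta>\<close>, meaningful for \<open>\<theta>\<^sub>i\<close> only where the solution of that index
  exists.\<close>

definition level_angles ::
  "real \<Rightarrow> real \<Rightarrow> real \<Rightarrow> (real \<Rightarrow> real) \<Rightarrow> (real \<Rightarrow> real) \<Rightarrow> (real \<Rightarrow> real) \<Rightarrow> bool" where
  "level_angles \<beta>\<^sub>0 \<beta>\<^sub>2 \<beta>\<^sub>3 \<theta>\<^sub>1 \<theta>\<^sub>2 \<theta>\<^sub>3 \<longleftrightarrow>
     0 < \<beta>\<^sub>0 \<and> \<beta>\<^sub>0 < \<beta>\<^sub>2 \<and> \<beta>\<^sub>2 < \<beta>\<^sub>3 \<and>
     (\<forall>\<beta> \<in> {0<..<\<beta>\<^sub>0}. \<theta>\<^sub>1 \<beta> < \<theta>\<^sub>2 \<beta> \<and> \<theta>\<^sub>2 \<beta> < \<theta>\<^sub>3 \<beta> \<and> level_set \<beta> = {\<theta>\<^sub>1 \<beta>, \<theta>\<^sub>2 \<beta>, \<theta>\<^sub>3 \<beta>}) \<and>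
     (\<forall>\<beta> \<in> {\<beta>\<^sub>0..<\<beta>\<^sub>2}. \<theta>\<^sub>2 \<beta> < \<theta>\<^sub>3 \<beta> \<and> level_set \<beta> = {\<theta>\<^sub>2 \<beta>, \<theta>\<^sub>3 \<beta>}) \<and>
     (\<forall>\<beta> \<in> {\<beta>\<^sub>2..<\<beta>\<^sub>3}. level_set \<beta> = {\<theta>\<^sub>3 \<beta>}) \<and>
     (\<forall>\<beta> \<in> {\<beta>\<^sub>3..}. level_set \<beta> = {})"

definition assumption_A1 ::
  "real \<Rightarrow> real \<Rightarrow> real \<Rightarrow> real \<Rightarrow> (real \<Rightarrow> real) \<Rightarrow> (real \<Rightarrow> real) \<Rightarrow> (real \<Rightarrow> real) \<Rightarrow> bool" where
  "assumption_A1 \<beta>\<^sub>0 \<beta>\<^sub>1 \<beta>\<^sub>2 \<beta>\<^sub>3 \<theta>\<^sub>1 \<theta>\<^sub>2 \<theta>\<^sub>3 \<longleftrightarrow>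
     strict_antimono_on {0<..<\<beta>\<^sub>0} \<theta>\<^sub>1 \<and>
     strict_antimono_on {0<..<\<beta>\<^sub>2} \<theta>\<^sub>2 \<and>
     strict_antimono_on {0<..<\<beta>\<^sub>3} \<theta>\<^sub>3 \<and>
     \<theta>\<^sub>2 \<beta>\<^sub>0 + \<theta>\<^sub>3 \<beta>\<^sub>0 > 2 * pi \<and>
     \<beta>\<^sub>1 \<in> {\<beta>\<^sub>0<..<\<beta>\<^sub>2} \<and>
     (\<forall>\<beta> \<in> {\<beta>\<^sub>0<..<\<beta>\<^sub>2}. \<theta>\<^sub>2 \<beta> + \<theta>\<^sub>3 \<beta> = 2 * pi \<longleftrightarrow> \<beta> = \<beta>\<^sub>1) \<and>
     \<theta>\<^sub>3 \<beta>\<^sub>2 > pi \<and>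
     (\<forall>\<beta> \<in> {0<..<\<beta>\<^sub>0}. 0 < \<theta>\<^sub>1 \<beta> \<and> \<theta>\<^sub>1 \<beta> < 2 * pi - \<theta>\<^sub>3 \<beta> \<and> 2 * pi - \<theta>\<^sub>3 \<beta> < \<theta>\<^sub>2 \<beta> \<and>
        \<theta>\<^sub>2 \<beta> < 2 * pi - \<theta>\<^sub>2 \<beta> \<and> 2 * pi - \<theta>\<^sub>2 \<beta> < \<theta>\<^sub>3 \<beta> \<and> \<theta>\<^sub>3 \<beta> < 2 * pi - \<theta>\<^sub>1 \<beta> \<and>
        2 * pi - \<theta>\<^sub>1 \<beta> < 2 * pi) \<and>
     (\<forall>\<beta> \<in> {\<beta>\<^sub>0<..<\<beta>\<^sub>1}. 0 < 2 * pi - \<theta>\<^sub>3 \<beta> \<and> 2 * pi - \<theta>\<^sub>3 \<beta> < \<theta>\<^sub>2 \<beta> \<and>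
        \<theta>\<^sub>2 \<beta> < 2 * pi - \<theta>\<^sub>2 \<beta> \<and> 2 * pi - \<theta>\<^sub>2 \<beta> < \<theta>\<^sub>3 \<beta> \<and> \<theta>\<^sub>3 \<beta> < 2 * pi) \<and>
     (\<forall>\<beta> \<in> {\<beta>\<^sub>1<..<\<beta>\<^sub>2}. 0 < \<theta>\<^sub>2 \<beta> \<and> \<theta>\<^sub>2 \<beta> < 2 * pi - \<theta>\<^sub>3 \<beta> \<and> 2 * pi - \<theta>\<^sub>3 \<beta> < \<theta>\<^sub>3 \<beta> \<and>
        \<theta>\<^sub>3 \<beta> < 2 * pi - \<theta>\<^sub>2 \<beta> \<and> 2 * pi - \<theta>\<^sub>2 \<beta> < 2 * pi) \<and>
     (\<forall>\<beta> \<in> {\<beta>\<^sub>2<..<1}. 0 < 2 * pi - \<theta>\<^sub>3 \<beta> \<and> 2 * pi - \<theta>\<^sub>3 \<beta> < \<theta>\<^sub>3 \<beta> \<and> \<theta>\<^sub>3 \<beta> < 2 * pi) \<and>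
     (\<forall>\<beta> \<in> {1<..<\<beta>\<^sub>3}. 0 < \<theta>\<^sub>3 \<beta> \<and> \<theta>\<^sub>3 \<beta> < 2 * pi - \<theta>\<^sub>3 \<beta> \<and> 2 * pi - \<theta>\<^sub>3 \<beta> < 2 * pi)"

definition A2_angle :: "real \<Rightarrow> real \<Rightarrow> bool" where
  "A2_angle \<beta> \<alpha> \<longleftrightarrow> \<alpha> \<in> {pi<..<2 * pi} \<and>
     (\<forall>\<theta> \<in> {0<..<\<alpha>}. kernel' \<beta> \<theta> > kernel'_zero \<beta>) \<and>
     kernel' \<beta> \<alpha> = kernel'_zero \<beta> \<and>
     (\<forall>\<theta> \<in> {\<alpha><..<2 * pi}. kernel' \<beta> \<theta> < kernel'_zero \<beta>)"

definition assumption_A2 :: bool where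
  "assumption_A2 \<longleftrightarrow>
     (\<forall>\<beta>>0. (\<exists>!\<alpha>. A2_angle \<beta> \<alpha>) \<and> (\<forall>\<alpha>. A2_angle \<beta> \<alpha> \<longrightarrow> kernel'' \<beta> \<alpha> < 0))"

text \<open>Used for \<open>0 < \<theta> < 2\<pi>\<close> only.\<close>

definition F_fun :: "real \<Rightarrow> real \<Rightarrow> real" where
  "F_fun \<beta> \<theta> = kernel \<beta> 0 * (kernel' \<beta> (- \<theta>) - kernel' \<beta> \<theta>)
          + kernel \<beta> \<theta> * (kernel'_zero \<beta> - kernel' \<beta> (- \<theta>))
          + kernel \<beta> (- \<theta>) * (kernel' \<beta> \<theta> - kernel'_zero \<beta>)"

text \<open>Besides the statement about \<open>\<beta>\<^sup>*\<close>, this fixes \<open>\<theta>b \<beta>\<close> (written \<open>\<theta>\<close> with a bar in the source) for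
  \<open>0 < \<beta> < \<beta>\<^sup>*\<close> as the unique zero of \<open>F_fun \<beta>\<close> in \<open>(0, \<pi>)\<close>.\<close>

definition assumption_A3 :: "real \<Rightarrow> real \<Rightarrow> real \<Rightarrow> (real \<Rightarrow> real) \<Rightarrow> bool" where
  "assumption_A3 \<beta>\<^sub>1 \<beta>\<^sub>2 \<beta>s \<theta>b \<longleftrightarrow>
     0 < \<beta>s \<and>
     (\<forall>\<beta>>0. deriv (F_fun \<beta>) pi = 0 \<longleftrightarrow> \<beta> = \<beta>s) \<and>
     (\<forall>\<beta> \<in> {0<..<\<beta>s}. deriv (F_fun \<beta>) pi > 0) \<and>
     (\<forall>\<beta> \<in> {\<beta>s<..}. deriv (F_fun \<beta>) pi < 0) \<and>
     (\<forall>\<beta> \<in> {0<..<\<beta>s}. (\<forall>\<theta> \<in> {0<..<pi}. F_fun \<beta> \<theta> = 0 \<longleftrightarrow> \<theta> = \<theta>b \<beta>) \<and>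
        \<theta>b \<beta> \<in> {0<..<pi} \<and> deriv (F_fun \<beta>) (\<theta>b \<beta>) < 0) \<and>
     (\<forall>\<beta> \<in> {\<beta>s<..}. \<not> (\<exists>\<theta> \<in> {0<..<pi}. F_fun \<beta> \<theta> = 0)) \<and>
     \<beta>s \<in> {\<beta>\<^sub>1<..<\<beta>\<^sub>2}"

definition assumption_A4 :: "real \<Rightarrow> real \<Rightarrow> (real \<Rightarrow> real) \<Rightarrow> (real \<Rightarrow> real) \<Rightarrow> bool" where
  "assumption_A4 \<beta>\<^sub>1 \<beta>s \<theta>\<^sub>2 \<theta>b \<longleftrightarrow>
     (\<forall>\<beta> \<in> {0<..<\<beta>\<^sub>1}. \<forall>\<theta> \<in> {\<theta>\<^sub>2 \<beta><..<2 * pi - \<theta>\<^sub>2 \<beta>}. \<forall>\<eta> \<in> {\<theta>\<^sub>2 \<beta><..<2 * pi - \<theta>\<^sub>2 \<beta>}.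
        \<bar>kernel'' \<beta> \<theta> / (kernel' \<beta> \<theta> - kernel'_zero \<beta>)
          + kernel'' \<beta> (- \<theta>) / (kernel' \<beta> (- \<theta>) - kernel'_zero \<beta>)\<bar>
        < kernel' \<beta> \<eta> / (kernel \<beta> \<eta> - kernel \<beta> 0)
          + kernel' \<beta> (- \<eta>) / (kernel \<beta> (- \<eta>) - kernel \<beta> 0)) \<and>
     (\<forall>\<beta> \<in> {\<beta>\<^sub>1<..<\<beta>s}. \<forall>\<theta> \<in> {\<theta>b \<beta><..<2 * pi - \<theta>b \<beta>}.
        kernel'' \<beta> \<theta> / (kernel' \<beta> \<theta> - kernel'_zero \<beta>)
          + kernel'' \<beta> (- \<theta>) / (kernel' \<beta> (- \<theta>) - kernel'_zero \<beta>) > 0)"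

definition R_ratio :: "real \<Rightarrow> real \<Rightarrow> real" where
  "R_ratio \<beta> \<theta> =
     (kernel' \<beta> \<theta> - kernel'_zero \<beta>) / (kernel' \<beta> (- \<theta>) - kernel'_zero \<beta>)"

end

theory Submission
  imports Defs
begin

text \<open>
  On \<open>[0, 2\<pi>]\<close> the kernel coincides with a single exponentially growing oscillation
  \<open>g \<theta> = e\<^sup>a\<^sup>\<theta> (P cos b\<theta> + Q sin b\<theta>)\<close>, called \<open>branch\<close> below, with \<open>a = 2\<beta>/(1+\<beta>\<^sup>2)\<close> and
  \<open>b = 2/(1+\<beta>\<^sup>2)\<close>; it is smooth on the whole line, and \<open>K(-\<theta>) = g(2\<pi> - \<theta>)\<close>. On the strip the vector
  field therefore agrees with a smooth field on the plane, and each equilibrium is classified by the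
  trace and the determinant of one explicit \<open>2 \<times> 2\<close> matrix. Write \<open>m\<close> for \<open>K'(0)\<close>, which is
  \<open>mean_slope\<close> below. The closed form of \<open>g\<close> gives \<open>g'(0) = m + b/4\<close>, \<open>g'(2\<pi>) = m - b/4\<close>, \<open>m < 0\<close>
  and \<open>g'(\<pi>) + m < 0\<close>; both inequalities come from \<open>sin x \<le> x < sinh x\<close>.

  On the axis \<open>R = 0\<close> the Jacobian is triangular with eigenvalues \<open>2 (g' \<theta> - m)\<close> and \<open>2 g' \<theta>\<close>, so
  the type of \<open>(0, \<theta>\<^sub>i)\<close> is read off from the sign of \<open>g'\<close> at a point where \<open>g\<close> takes the value \<open>g 0\<close>;
  there \<open>g' \<theta> > m\<close>, because beyond the angle \<open>\<alpha>\<close> at which \<open>g' - m\<close> changes sign the branch lies above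
  \<open>g 0\<close> (\<open>level_point_slope_gt_mean\<close>). On the edges of the strip everything is explicit through the jump
  \<open>b/2\<close> of the slope, except for the sign of \<open>g'(0)\<close>. A level point is never critical (\<open>branch'_nonzero_at_level_point\<close>), so \<open>g'\<close> alternates in sign
  along the solutions of \<open>K \<theta> = K 0\<close>, starting from \<open>g'(2\<pi>) < 0\<close> and going left. That determines all
  the signs. It also shows that \<open>g'(0)\<close>, which governs \<open>(0, 0)\<close>, has a weak sign given by the parity of
  the number of solutions. The sign is strict on open ranges of \<open>\<beta>\<close> because, up to a positive factor,
  \<open>g'(0)\<close> is a function of \<open>\<beta>\<close> with only simple zeros (\<open>slope_sign_simple_zero\<close>); a zero inside such a
  range would be accompanied by both signs nearby.

  For \<open>R \<noteq> 0\<close> and \<open>0 < \<theta> < 2\<pi>\<close> the two equilibrium equations are linear in \<open>R\<close> and are compatible only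
  if \<open>F \<theta> = 0\<close>; since \<open>F\<close> is odd about \<open>\<pi>\<close>, the hypothesis on its zeros leaves \<open>\<pi>\<close> and, below
  the critical parameter, the pair \<open>\<theta>b, 2\<pi> - \<theta>b\<close>. At such an equilibrium the determinant of the
  Jacobian is \<open>4 R F' \<theta>\<close> (\<open>jac_det_interior\<close>), so the types follow from the given signs of \<open>F'\<close> once \<open>R > 0\<close> is known. At
  \<open>\<pi>\<close> the ratio is \<open>1\<close>, and the trace \<open>2 (g' \<pi> + m)\<close> is negative. At \<open>\<theta>b\<close>, positivity of the ratio
  means that \<open>2\<pi> - \<theta>b\<close> lies to the left of \<open>\<alpha>\<close>; this holds
  because \<open>F\<close> is positive at \<open>2\<pi> - \<alpha>\<close> and negative just before \<open>\<pi>\<close>, so that its unique zero lies in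
  between (\<open>slopes_gt_mean_at_elim_zero\<close>).
\<close>

section \<open>Spectra of two-by-two matrices\<close>

lemma det_2x2:
  fixes A :: "'a::comm_ring_1 mat"
  assumes A: "A \<in> carrier_mat 2 2"
  shows "det A = A $$ (0, 0) * A $$ (1, 1) - A $$ (0, 1) * A $$ (1, 0)"
proof -
  have d: "det (mat_delete A 0 j) = A $$ (1, 1 - j)" if "j < 2" for j
  proof -
    have "mat_delete A 0 j \<in> carrier_mat 1 1"
      using mat_delete_carrier[of A 2 2 0 j] A by simp
    then have "det (mat_delete A 0 j) = mat_delete A 0 j $$ (0, 0)"
      by (rule det_single)
    also have "\<dots> = A $$ (1, 1 - j)"
      using A that by (auto simp: mat_delete_def less_2_cases_iff)
    finally show ?thesis .
  qed
  have "det A = (\<Sum>j<2. A $$ (0, j) * cofactor A 0 j)"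
    by (rule laplace_expansion_row[OF A]) simp
  also have "{..<2::nat} = {0, 1}"
    by auto
  finally show ?thesis
    by (simp add: cofactor_def d)
qed

lemma spectrum_2x2:
  fixes A :: "real mat"
  assumes A: "A \<in> carrier_mat 2 2"
  shows "spectrum (map_mat complex_of_real A) =
    {z. z\<^sup>2 - complex_of_real (A $$ (0, 0) + A $$ (1, 1)) * z
        + complex_of_real (A $$ (0, 0) * A $$ (1, 1) - A $$ (0, 1) * A $$ (1, 0)) = 0}"
proof -
  let ?B = "map_mat complex_of_real A"
  have B: "?B \<in> carrier_mat 2 2"
    using A by simp
  have "eigenvalue ?B z \<longleftrightarrow>
      (?B $$ (0, 0) - z) * (?B $$ (1, 1) - z) - ?B $$ (0, 1) * ?B $$ (1, 0) = 0" for z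
  proof -
    have "char_matrix ?B z \<in> carrier_mat 2 2"
      using B by simp
    from det_2x2[OF this] show ?thesis
      unfolding eigenvalue_det[OF B] using A by (simp add: char_matrix_def)
  qed
  then show ?thesis
    unfolding spectrum_def using A by (auto simp: algebra_simps power2_eq_square)
qed

text \<open>The Routh-Hurwitz criterion in degree two: a non-real root has real part \<open>t / 2\<close>, while for a real
  root a wrong sign would make every term of the equation nonnegative and \<open>d\<close> positive.\<close>

lemma complex_quadratic_root_Re:
  fixes t d :: real
  assumes z: "z\<^sup>2 - complex_of_real t * z + complex_of_real d = 0"
  shows "d > 0 \<Longrightarrow> t < 0 \<Longrightarrow> Re z < 0" and "d > 0 \<Longrightarrow> t > 0 \<Longrightarrow> Re z > 0"
proof -
  from arg_cong[OF z, of Re] arg_cong[OF z, of Im]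
  have re: "(Re z)\<^sup>2 - (Im z)\<^sup>2 - t * Re z + d = 0" and im: "Im z * (2 * Re z - t) = 0"
    by (simp_all add: power2_eq_square algebra_simps)
  from im consider "Im z = 0" | "Re z = t / 2"
    by auto
  note cs = this
  show "Re z < 0" if "d > 0" "t < 0"
    using cs
  proof cases
    case 1
    show ?thesis
    proof (rule ccontr)
      assume "\<not> Re z < 0"
      then have "t * Re z \<le> 0"
        using that by (simp add: mult_nonpos_nonneg)
      then show False
        using re 1 that zero_le_power2[of "Re z"] by simp
    qed
  qed (use that in simp)
  show "Re z > 0" if "d > 0" "t > 0"
    using cs
  proof cases
    case 1
    show ?thesis
    proof (rule ccontr)
      assume "\<not> Re z > 0"
      then have "t * Re z \<le> 0"
        using that by (simp add: mult_nonneg_nonpos)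
      then show False
        using re 1 that zero_le_power2[of "Re z"] by simp
    qed
  qed (use that in simp)
qed

lemma complex_quadratic_roots_real:
  fixes t d :: real
  assumes "d < 0"
  obtains p q where "p < 0" "0 < q"
    "{z. z\<^sup>2 - complex_of_real t * z + complex_of_real d = 0} = {complex_of_real p, complex_of_real q}"
proof -
  define r where "r = sqrt (t\<^sup>2 - 4 * d)"
  have r2: "r\<^sup>2 = t\<^sup>2 - 4 * d"
    unfolding r_def using assms zero_le_power2[of t] by (intro real_sqrt_pow2) linarith
  have r: "r > \<bar>t\<bar>"
    unfolding r_def using assms by (intro real_less_rsqrt) auto
  define p where "p = (t - r) / 2"
  define q where "q = (t + r) / 2"
  have pq: "t = p + q" "d = p * q"
    using r2 by (simp_all add: p_def q_def field_simps power2_eq_square)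
  have "z\<^sup>2 - complex_of_real t * z + complex_of_real d
      = (z - complex_of_real p) * (z - complex_of_real q)" for z
    unfolding pq by (simp add: algebra_simps power2_eq_square)
  then have "{z. z\<^sup>2 - complex_of_real t * z + complex_of_real d = 0}
      = {complex_of_real p, complex_of_real q}"
    by auto
  moreover have "p < 0" "0 < q"
    using r by (auto simp: p_def q_def)
  ultimately show thesis
    using that by blast
qed

section \<open>The kernel as an exponentially growing oscillation\<close>

definition rate :: "real \<Rightarrow> real" where
  "rate \<beta> = 2 * \<beta> / (1 + \<beta>\<^sup>2)"

definition freq :: "real \<Rightarrow> real" where
  "freq \<beta> = 2 / (1 + \<beta>\<^sup>2)"

text \<open>With \<open>z = \<pi> (b + i a)\<close> the argument of the sine in the kernel, this is \<open>8 |sin z|\<^sup>2\<close>.\<close>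

definition norm_const :: "real \<Rightarrow> real" where
  "norm_const \<beta> = 4 * (cosh (2 * pi * rate \<beta>) - cos (2 * pi * freq \<beta>))"

definition cos_coeff :: "real \<Rightarrow> real" where
  "cos_coeff \<beta> = sin (2 * pi * freq \<beta>) / norm_const \<beta>"

definition sin_coeff :: "real \<Rightarrow> real" where
  "sin_coeff \<beta> = (exp (- (2 * pi * rate \<beta>)) - cos (2 * pi * freq \<beta>)) / norm_const \<beta>"

definition branch :: "real \<Rightarrow> real \<Rightarrow> real" where
  "branch \<beta> \<theta> = exp (rate \<beta> * \<theta>) *
     (cos_coeff \<beta> * cos (freq \<beta> * \<theta>) + sin_coeff \<beta> * sin (freq \<beta> * \<theta>))"

definition branch' :: "real \<Rightarrow> real \<Rightarrow> real" where
  "branch' \<beta> \<theta> = exp (rate \<beta> * \<theta>) *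
     ((rate \<beta> * cos_coeff \<beta> + freq \<beta> * sin_coeff \<beta>) * cos (freq \<beta> * \<theta>)
      + (rate \<beta> * sin_coeff \<beta> - freq \<beta> * cos_coeff \<beta>) * sin (freq \<beta> * \<theta>))"

text \<open>The linear oscillator equation with constant coefficients, solved for the second derivative.\<close>

definition branch'' :: "real \<Rightarrow> real \<Rightarrow> real" where
  "branch'' \<beta> \<theta> = 2 * rate \<beta> * branch' \<beta> \<theta> - ((rate \<beta>)\<^sup>2 + (freq \<beta>)\<^sup>2) * branch \<beta> \<theta>"

lemma rate_pos: "\<beta> > 0 \<Longrightarrow> rate \<beta> > 0"
  and freq_pos: "freq \<beta> > 0"
  and rate_eq: "rate \<beta> = \<beta> * freq \<beta>"
  by (simp_all add: rate_def freq_def add_pos_nonneg)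

lemma cosh_gt_one: "cosh x > 1" if "x > 0" for x :: real
proof (rule power2_less_imp_less)
  show "1\<^sup>2 < (cosh x)\<^sup>2"
    using that unfolding cosh_square_eq by simp
qed simp

lemma less_sinh: "x < sinh x" if "x > 0" for x :: real
proof -
  have "sinh 0 - 0 < sinh x - x"
  proof (rule DERIV_pos_imp_increasing_open[OF that])
    fix t :: real
    assume "0 < t" "t < x"
    have "((\<lambda>t. sinh t - t) has_real_derivative cosh t - 1) (at t)"
      by (auto intro!: derivative_eq_intros)
    then show "\<exists>d. ((\<lambda>t. sinh t - t) has_real_derivative d) (at t) \<and> d > 0"
      using cosh_gt_one[OF \<open>0 < t\<close>] by auto
  qed (intro continuous_intros)
  then show ?thesis by simp
qed

lemma norm_const_pos: "norm_const \<beta> > 0" if "\<beta> > 0"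
proof -
  have "cosh (2 * pi * rate \<beta>) > 1"
    using rate_pos[OF that] by (intro cosh_gt_one) simp
  with cos_le_one have "cos (2 * pi * freq \<beta>) < cosh (2 * pi * rate \<beta>)"
    by (rule le_less_trans)
  then show ?thesis
    by (simp add: norm_const_def)
qed

lemma has_real_derivative_branch:
  "(branch \<beta> has_real_derivative branch' \<beta> \<theta>) (at \<theta>)"
  unfolding branch_def[abs_def] branch'_def
  by (rule derivative_eq_intros refl)+ (simp add: algebra_simps)

lemma has_real_derivative_branch':
  "(branch' \<beta> has_real_derivative branch'' \<beta> \<theta>) (at \<theta>)"
  unfolding branch'_def[abs_def] branch''_def branch_def branch'_def
  by (rule derivative_eq_intros refl)+ (simp add: algebra_simps power2_eq_square)

text \<open>Expanding around \<open>\<pi>\<close>, the point of reference in the definition of the kernel, makes the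
  coefficients, up to a common factor, the real and imaginary parts of \<open>1 / sin z\<close>.\<close>

lemma branch_symmetric_form:
  assumes "\<beta> > 0"
  shows "branch \<beta> \<theta> = exp (rate \<beta> * (\<theta> - pi)) * (2 / norm_const \<beta>) *
    (cos (freq \<beta> * (\<theta> - pi)) * (sin (pi * freq \<beta>) * cosh (pi * rate \<beta>))
     - sin (freq \<beta> * (\<theta> - pi)) * (cos (pi * freq \<beta>) * sinh (pi * rate \<beta>)))"
proof -
  define s c where "s = sin (pi * freq \<beta>)" and "c = cos (pi * freq \<beta>)"
  define x y where "x = exp (pi * rate \<beta>)" and "y = exp (- (pi * rate \<beta>))"
  have xy: "x * y = 1"
    by (simp add: x_def y_def flip: exp_add)
  have sc: "c * c = 1 - s * s"
    using sin_cos_squared_add[of "pi * freq \<beta>"] by (simp add: s_def c_def power2_eq_square)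
  have e: "exp (rate \<beta> * (\<theta> - pi)) = exp (rate \<beta> * \<theta>) * y"
    by (simp add: y_def algebra_simps flip: exp_add)
  have e2: "exp (- (2 * pi * rate \<beta>)) = y * y"
    by (simp add: y_def flip: exp_add)
  have s2: "sin (2 * pi * freq \<beta>) = 2 * s * c" and c2: "cos (2 * pi * freq \<beta>) = 1 - 2 * s * s"
    using sin_double[of "pi * freq \<beta>"] cos_double_sin[of "pi * freq \<beta>"]
    by (simp_all add: s_def c_def power2_eq_square mult.assoc)
  have cd: "cos (freq \<beta> * (\<theta> - pi)) = cos (freq \<beta> * \<theta>) * c + sin (freq \<beta> * \<theta>) * s"
    and sd: "sin (freq \<beta> * (\<theta> - pi)) = sin (freq \<beta> * \<theta>) * c - cos (freq \<beta> * \<theta>) * s"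
    by (simp_all add: s_def c_def right_diff_distrib cos_diff sin_diff mult.commute[of pi])
  have key: "2 * s * c * C + (y * y - (1 - 2 * s * s)) * S
      = y * ((C * c + S * s) * (s * (x + y)) - (S * c - C * s) * (c * (x - y)))" for C S
  proof -
    have "y * ((C * c + S * s) * (s * (x + y)) - (S * c - C * s) * (c * (x - y)))
      = (x * y) * (2 * s * c * C + S * (s * s - c * c)) + y * y * S * (s * s + c * c)"
      by (simp add: algebra_simps)
    then show ?thesis
      unfolding xy sc by (simp add: algebra_simps)
  qed
  have "branch \<beta> \<theta> = exp (rate \<beta> * \<theta>) / norm_const \<beta> *
      (2 * s * c * cos (freq \<beta> * \<theta>) + (y * y - (1 - 2 * s * s)) * sin (freq \<beta> * \<theta>))"
    unfolding s2[symmetric] c2[symmetric] e2[symmetric] using norm_const_pos[OF assms]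
    by (simp add: branch_def cos_coeff_def sin_coeff_def field_simps)
  also have "\<dots> = exp (rate \<beta> * (\<theta> - pi)) * (2 / norm_const \<beta>) *
    (cos (freq \<beta> * (\<theta> - pi)) * (s * ((x + y) / 2))
     - sin (freq \<beta> * (\<theta> - pi)) * (c * ((x - y) / 2)))"
    unfolding key e cd sd using norm_const_pos[OF assms] by (simp add: field_simps)
  also have "(x + y) / 2 = cosh (pi * rate \<beta>)"
    by (simp add: x_def y_def cosh_field_def)
  also have "(x - y) / 2 = sinh (pi * rate \<beta>)"
    by (simp add: x_def y_def sinh_field_def)
  finally show ?thesis
    by (simp add: s_def c_def)
qed

lemma kernel_eq_branch:
  assumes \<beta>: "\<beta> > 0" and \<theta>: "0 \<le> \<theta>" "\<theta> \<le> 2 * pi"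
  shows "kernel \<beta> \<theta> = branch \<beta> \<theta>"
proof -
  define X Y where "X = pi * freq \<beta>" and "Y = pi * rate \<beta>"
  have n: "1 + \<beta>\<^sup>2 > 0"
    by (simp add: add_pos_nonneg)
  have n': "1 + (complex_of_real \<beta>)\<^sup>2 = complex_of_real (1 + \<beta>\<^sup>2)"
    by simp
  have w: "2 * (complex_of_real \<beta> - \<i>) / (1 + (complex_of_real \<beta>)\<^sup>2) * complex_of_real (\<theta> - pi)
      = Complex (rate \<beta> * (\<theta> - pi)) (- (freq \<beta> * (\<theta> - pi)))"
    unfolding n' using n by (simp add: complex_eq_iff rate_def freq_def diff_divide_distrib)
  have z: "2 * complex_of_real pi * (1 + \<i> * complex_of_real \<beta>) / (1 + (complex_of_real \<beta>)\<^sup>2)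
      = Complex X Y"
    unfolding n' using n by (simp add: complex_eq_iff rate_def freq_def X_def Y_def)
  have sin_z: "sin (Complex X Y) = Complex (sin X * cosh Y) (cos X * sinh Y)"
    by (simp add: complex_eq_iff Re_sin Im_sin cosh_field_def sinh_field_def)
  have "(sin X * cosh Y)\<^sup>2 + (cos X * sinh Y)\<^sup>2 = (sin X)\<^sup>2 + (sinh Y)\<^sup>2"
    by (simp add: power_mult_distrib cosh_square_eq cos_squared_eq algebra_simps)
  also have "\<dots> = norm_const \<beta> / 8"
  proof -
    have "cosh (2 * pi * rate \<beta>) = 1 + 2 * (sinh Y)\<^sup>2"
      using cosh_double[of Y] by (simp add: cosh_square_eq Y_def mult.assoc)
    moreover have "cos (2 * pi * freq \<beta>) = 1 - 2 * (sin X)\<^sup>2"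
      using cos_double_sin[of X] by (simp add: X_def mult.assoc)
    ultimately show ?thesis
      by (simp add: norm_const_def)
  qed
  finally have N: "(sin X * cosh Y)\<^sup>2 + (cos X * sinh Y)\<^sup>2 = norm_const \<beta> / 8" .
  have "kernel \<beta> \<theta> = 1 / 4 * Re (exp (Complex (rate \<beta> * (\<theta> - pi)) (- (freq \<beta> * (\<theta> - pi))))
      / Complex (sin X * cosh Y) (cos X * sinh Y))"
    using kernel_eq[of \<beta> \<theta>] \<beta> \<theta> unfolding w z sin_z by simp
  also have "\<dots> = branch \<beta> \<theta>"
    unfolding branch_symmetric_form[OF \<beta>]
    using norm_const_pos[OF \<beta>]
    by (simp add: Re_divide Re_exp Im_exp N) (simp add: X_def Y_def field_simps)
  finally show ?thesis .
qed

lemma branch_endpoints: "branch \<beta> (2 * pi) = branch \<beta> 0"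
proof -
  have "exp (rate \<beta> * (2 * pi)) * exp (- (2 * pi * rate \<beta>)) = 1"
    by (simp add: algebra_simps flip: exp_add)
  moreover have "branch \<beta> (2 * pi) = (exp (rate \<beta> * (2 * pi)) * exp (- (2 * pi * rate \<beta>)))
      * sin (2 * pi * freq \<beta>) / norm_const \<beta>"
    by (simp add: branch_def cos_coeff_def sin_coeff_def algebra_simps add_divide_distrib diff_divide_distrib)
  ultimately show ?thesis
    by (simp add: branch_def cos_coeff_def)
qed

lemma branch'_0:
  "branch' \<beta> 0 = (rate \<beta> * sin (2 * pi * freq \<beta>)
     + freq \<beta> * (exp (- (2 * pi * rate \<beta>)) - cos (2 * pi * freq \<beta>))) / norm_const \<beta>"
  by (simp add: branch'_def cos_coeff_def sin_coeff_def add_divide_distrib)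

lemma branch'_2pi:
  "branch' \<beta> (2 * pi) = (rate \<beta> * sin (2 * pi * freq \<beta>)
     + freq \<beta> * (cos (2 * pi * freq \<beta>) - exp (2 * pi * rate \<beta>))) / norm_const \<beta>"
proof -
  define s c where "s = sin (2 * pi * freq \<beta>)" and "c = cos (2 * pi * freq \<beta>)"
  define x y where "x = exp (2 * pi * rate \<beta>)" and "y = exp (- (2 * pi * rate \<beta>))"
  have xy: "x * y = 1"
    by (simp add: x_def y_def flip: exp_add)
  have sc: "s * s + c * c = 1"
    using sin_cos_squared_add[of "2 * pi * freq \<beta>"] by (simp add: s_def c_def power2_eq_square)
  have "branch' \<beta> (2 * pi)
      = x * ((rate \<beta> * s + freq \<beta> * (y - c)) * c + (rate \<beta> * (y - c) - freq \<beta> * s) * s) / norm_const \<beta>"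
    by (simp add: branch'_def cos_coeff_def sin_coeff_def s_def c_def x_def y_def
        add_divide_distrib diff_divide_distrib mult.commute algebra_simps)
  also have "x * ((rate \<beta> * s + freq \<beta> * (y - c)) * c + (rate \<beta> * (y - c) - freq \<beta> * s) * s)
      = (x * y) * (rate \<beta> * s + freq \<beta> * c) - freq \<beta> * x * (s * s + c * c)"
    by (simp add: algebra_simps)
  finally show ?thesis
    unfolding xy sc by (simp add: s_def c_def x_def algebra_simps)
qed

lemma branch'_pi:
  "branch' \<beta> pi = 2 * (rate \<beta> * cosh (pi * rate \<beta>) * sin (pi * freq \<beta>)
     - freq \<beta> * sinh (pi * rate \<beta>) * cos (pi * freq \<beta>)) / norm_const \<beta>"
proof -
  define s c where "s = sin (pi * freq \<beta>)" and "c = cos (pi * freq \<beta>)"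
  define x y where "x = exp (pi * rate \<beta>)" and "y = exp (- (pi * rate \<beta>))"
  have xy: "x * y = 1"
    by (simp add: x_def y_def flip: exp_add)
  have sc: "c * c = 1 - s * s"
    using sin_cos_squared_add[of "pi * freq \<beta>"] by (simp add: s_def c_def power2_eq_square)
  have e2: "exp (- (2 * pi * rate \<beta>)) = y * y"
    by (simp add: y_def flip: exp_add)
  have s2: "sin (2 * pi * freq \<beta>) = 2 * s * c" and c2: "cos (2 * pi * freq \<beta>) = c * c - s * s"
    using sin_double[of "pi * freq \<beta>"] cos_double[of "pi * freq \<beta>"]
    by (simp_all add: s_def c_def power2_eq_square mult.assoc)
  have "branch' \<beta> pi
      = x * ((rate \<beta> * (2 * s * c) + freq \<beta> * (y * y - (c * c - s * s))) * c
          + (rate \<beta> * (y * y - (c * c - s * s)) - freq \<beta> * (2 * s * c)) * s) / norm_const \<beta>"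
    unfolding s2[symmetric] c2[symmetric] e2[symmetric]
    by (simp add: branch'_def cos_coeff_def sin_coeff_def s_def c_def x_def
        add_divide_distrib diff_divide_distrib mult.commute algebra_simps)
  also have "x * ((rate \<beta> * (2 * s * c) + freq \<beta> * (y * y - (c * c - s * s))) * c
          + (rate \<beta> * (y * y - (c * c - s * s)) - freq \<beta> * (2 * s * c)) * s)
      = x * (s * s + c * c) * (rate \<beta> * s - freq \<beta> * c) + (x * y) * y * (freq \<beta> * c + rate \<beta> * s)"
    by (simp add: algebra_simps)
  also have "\<dots> = 2 * (rate \<beta> * ((x + y) / 2) * s - freq \<beta> * ((x - y) / 2) * c)"
    unfolding xy sc by (simp add: field_simps)
  also have "(x + y) / 2 = cosh (pi * rate \<beta>)"
    by (simp add: x_def y_def cosh_field_def)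
  also have "(x - y) / 2 = sinh (pi * rate \<beta>)"
    by (simp add: x_def y_def sinh_field_def)
  finally show ?thesis
    by (simp add: s_def c_def)
qed

definition mean_slope :: "real \<Rightarrow> real" where
  "mean_slope \<beta> = (branch' \<beta> 0 + branch' \<beta> (2 * pi)) / 2"

lemma mean_slope_eq:
  "mean_slope \<beta> = (rate \<beta> * sin (2 * pi * freq \<beta>) - freq \<beta> * sinh (2 * pi * rate \<beta>)) / norm_const \<beta>"
  unfolding mean_slope_def branch'_0 branch'_2pi sinh_field_def
  by (simp add: add_divide_distrib diff_divide_distrib algebra_simps)

text \<open>The corner of the kernel at \<open>0\<close>: its slope jumps there by \<open>b / 2\<close>.\<close>

lemma branch'_jump:
  assumes "\<beta> > 0"
  shows "branch' \<beta> 0 = mean_slope \<beta> + freq \<beta> / 4" "branch' \<beta> (2 * pi) = mean_slope \<beta> - freq \<beta> / 4"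
proof -
  have "branch' \<beta> 0 - branch' \<beta> (2 * pi)
      = 2 * freq \<beta> * (cosh (2 * pi * rate \<beta>) - cos (2 * pi * freq \<beta>)) / norm_const \<beta>"
    unfolding branch'_0 branch'_2pi cosh_field_def
    by (simp add: add_divide_distrib diff_divide_distrib algebra_simps)
  also have "\<dots> = freq \<beta> / 2"
  proof -
    have "2 * f * d / (4 * d) = f / 2" if "4 * d > 0" for f d :: real
      using that by simp
    with norm_const_pos[OF assms] show ?thesis
      unfolding norm_const_def by blast
  qed
  finally show "branch' \<beta> 0 = mean_slope \<beta> + freq \<beta> / 4"
      "branch' \<beta> (2 * pi) = mean_slope \<beta> - freq \<beta> / 4"
    by (simp_all add: mean_slope_def field_simps)
qed

text \<open>Both sides are compared with \<open>k a b\<close>. This one inequality gives the sign of the mean slope and the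
  sign of the trace at \<open>(1, \<pi>)\<close>.\<close>

lemma rate_sin_less_freq_sinh:
  assumes "\<beta> > 0" "k > 0"
  shows "rate \<beta> * sin (k * freq \<beta>) < freq \<beta> * sinh (k * rate \<beta>)"
proof -
  have "rate \<beta> * sin (k * freq \<beta>) \<le> rate \<beta> * (k * freq \<beta>)"
    using assms rate_pos[of \<beta>] freq_pos[of \<beta>] by (intro mult_left_mono sin_x_le_x) auto
  also have "\<dots> = freq \<beta> * (k * rate \<beta>)"
    by simp
  also have "\<dots> < freq \<beta> * sinh (k * rate \<beta>)"
    using assms rate_pos[of \<beta>] freq_pos[of \<beta>] by (intro mult_strict_left_mono less_sinh) auto
  finally show ?thesis .
qed

lemma mean_slope_neg: "mean_slope \<beta> < 0" if "\<beta> > 0"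
proof -
  have "rate \<beta> * sin (2 * pi * freq \<beta>) - freq \<beta> * sinh (2 * pi * rate \<beta>) < 0"
    using rate_sin_less_freq_sinh[OF that, of "2 * pi"] by simp
  then show ?thesis
    unfolding mean_slope_eq using norm_const_pos[OF that] by (rule divide_neg_pos)
qed

lemma branch'_pi_plus_mean_slope_neg:
  assumes "\<beta> > 0"
  shows "branch' \<beta> pi + mean_slope \<beta> < 0"
proof -
  define s c where "s = sin (pi * freq \<beta>)" and "c = cos (pi * freq \<beta>)"
  define S C where "S = sinh (pi * rate \<beta>)" and "C = cosh (pi * rate \<beta>)"
  have "sin (2 * pi * freq \<beta>) = 2 * s * c" "sinh (2 * pi * rate \<beta>) = 2 * S * C"
    using sin_double[of "pi * freq \<beta>"] sinh_double[of "pi * rate \<beta>"]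
    by (simp_all add: s_def c_def S_def C_def mult.assoc)
  then have "branch' \<beta> pi + mean_slope \<beta>
      = (2 * (rate \<beta> * C * s - freq \<beta> * S * c) + (rate \<beta> * (2 * s * c) - freq \<beta> * (2 * S * C)))
        / norm_const \<beta>"
    unfolding branch'_pi mean_slope_eq by (simp add: s_def c_def S_def C_def add_divide_distrib)
  \<comment> \<open>The factor \<open>cosh + cos\<close> splits off and leaves the difference estimated above.\<close>
  also have "\<dots> = 2 * (C + c) * (rate \<beta> * s - freq \<beta> * S) / norm_const \<beta>"
    by (simp add: algebra_simps)
  also have "\<dots> < 0"
  proof -
    have "C > 1"
      unfolding C_def using rate_pos[OF assms] by (intro cosh_gt_one) simp
    then have "C + c > 0"
      using cos_ge_minus_one[of "pi * freq \<beta>"] unfolding c_def by linarith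
    moreover have "rate \<beta> * s - freq \<beta> * S < 0"
      using rate_sin_less_freq_sinh[OF assms, of pi] by (simp add: s_def S_def)
    ultimately have "2 * (C + c) * (rate \<beta> * s - freq \<beta> * S) < 0"
      by (intro mult_pos_neg) auto
    then show ?thesis
      using norm_const_pos[OF assms] by (rule divide_neg_pos)
  qed
  finally show ?thesis .
qed

section \<open>The smooth field and its Jacobian\<close>

lemma kernel_uminus:
  assumes "\<beta> > 0" "0 \<le> \<theta>" "\<theta> \<le> 2 * pi"
  shows "kernel \<beta> (- \<theta>) = branch \<beta> (2 * pi - \<theta>)"
  using kernel_periodic[of \<beta> "- \<theta>"] kernel_eq_branch[of \<beta> "2 * pi - \<theta>"] assms
  by (simp add: algebra_simps)

lemma kernel_0: "\<beta> > 0 \<Longrightarrow> kernel \<beta> 0 = branch \<beta> 0"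
  by (simp add: kernel_eq_branch)

lemma kernel'_eq_branch':
  assumes "\<beta> > 0" "0 < \<theta>" "\<theta> < 2 * pi"
  shows "kernel' \<beta> \<theta> = branch' \<beta> \<theta>"
proof -
  have "(kernel \<beta> has_real_derivative branch' \<beta> \<theta>) (at \<theta>)"
    by (rule has_field_derivative_transform_within_open[OF has_real_derivative_branch, of "{0<..<2 * pi}"])
      (use assms in \<open>auto simp: kernel_eq_branch\<close>)
  then show ?thesis
    unfolding kernel'_def by (rule DERIV_imp_deriv)
qed

lemma kernel'_uminus:
  assumes "\<beta> > 0" "0 < \<theta>" "\<theta> < 2 * pi"
  shows "kernel' \<beta> (- \<theta>) = branch' \<beta> (2 * pi - \<theta>)"
proof -
  have "((\<lambda>t. branch \<beta> (t + 2 * pi)) has_real_derivative branch' \<beta> (- \<theta> + 2 * pi)) (at (- \<theta>))"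
    using DERIV_shift[of "branch \<beta>" _ "- \<theta>" "2 * pi"] has_real_derivative_branch by blast
  then have "(kernel \<beta> has_real_derivative branch' \<beta> (- \<theta> + 2 * pi)) (at (- \<theta>))"
    by (rule has_field_derivative_transform_within_open[of _ _ _ "{- (2 * pi)<..<0}"])
      (use assms kernel_uminus[OF assms(1), of "- _"] in \<open>auto simp: add.commute\<close>)
  then show ?thesis
    unfolding kernel'_def by (simp add: DERIV_imp_deriv)
qed

lemma isCont_branch': "isCont (branch' \<beta>) \<theta>"
  using has_real_derivative_branch' by (rule DERIV_isCont)

lemma kernel'_plus_eq:
  assumes "\<beta> > 0"
  shows "kernel'_plus \<beta> = branch' \<beta> 0"
proof -
  have "(branch' \<beta> \<longlongrightarrow> branch' \<beta> 0) (at_right 0)"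
    using isCont_branch'[where \<beta> = \<beta> and \<theta> = 0] unfolding isCont_def
    by (rule filterlim_mono) (auto intro: at_le)
  moreover have "\<forall>\<^sub>F \<theta> in at_right 0. branch' \<beta> \<theta> = kernel' \<beta> \<theta>"
    using eventually_at_right_real[of 0 "2 * pi"]
    by (auto elim!: eventually_mono simp: kernel'_eq_branch' assms)
  ultimately have "(kernel' \<beta> \<longlongrightarrow> branch' \<beta> 0) (at_right 0)"
    by (rule Lim_transform_eventually)
  then show ?thesis
    unfolding kernel'_plus_def by (intro tendsto_Lim) auto
qed

lemma kernel'_minus_eq:
  assumes "\<beta> > 0"
  shows "kernel'_minus \<beta> = branch' \<beta> (2 * pi)"
proof -
  have "((\<lambda>\<theta>. branch' \<beta> (\<theta> + 2 * pi)) \<longlongrightarrow> branch' \<beta> (0 + 2 * pi)) (at_left 0)"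
    using isCont_branch'[where \<beta> = \<beta> and \<theta> = "2 * pi"]
    by (intro isCont_tendsto_compose[of _ "branch' \<beta>"] tendsto_intros) simp
  moreover have "\<forall>\<^sub>F \<theta> in at_left 0. branch' \<beta> (\<theta> + 2 * pi) = kernel' \<beta> \<theta>"
    using eventually_at_left_real[of "- (2 * pi)" 0] kernel'_uminus[OF assms, of "- _"]
    by (auto elim!: eventually_mono simp: add.commute)
  ultimately have "(kernel' \<beta> \<longlongrightarrow> branch' \<beta> (0 + 2 * pi)) (at_left 0)"
    by (rule Lim_transform_eventually)
  then show ?thesis
    unfolding kernel'_minus_def by (intro tendsto_Lim) auto
qed

lemma kernel'_zero_eq: "\<beta> > 0 \<Longrightarrow> kernel'_zero \<beta> = mean_slope \<beta>"
  by (simp add: kernel'_zero_def mean_slope_def kernel'_plus_eq kernel'_minus_eq)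

text \<open>The vector field with the branch in place of the kernel. It is smooth on the whole plane, so its
  derivative serves as the one-sided derivative on the boundary of the strip.\<close>

definition smooth_field :: "real \<Rightarrow> real \<times> real \<Rightarrow> real \<times> real" where
  "smooth_field \<beta> = (\<lambda>(R, \<theta>).
     (2 * (mean_slope \<beta> - branch' \<beta> (2 * pi - \<theta>)) * R ^ 2 + 2 * (branch' \<beta> \<theta> - mean_slope \<beta>) * R,
      2 * (branch \<beta> 0 - branch \<beta> (2 * pi - \<theta>)) * R + 2 * (branch \<beta> \<theta> - branch \<beta> 0)))"

lemma vec_field_eq_smooth_field:
  assumes "\<beta> > 0" "p \<in> phase_space"
  shows "vec_field \<beta> p = smooth_field \<beta> p"
proof -
  obtain R \<theta> where p: "p = (R, \<theta>)"
    by force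
  have \<theta>: "0 \<le> \<theta>" "\<theta> \<le> 2 * pi"
    using assms p by (auto simp: phase_space_def)
  have "kernel'_pos \<beta> \<theta> = branch' \<beta> \<theta>" "kernel'_neg \<beta> \<theta> = branch' \<beta> (2 * pi - \<theta>)"
    using \<theta> assms(1)
    by (auto simp: kernel'_pos_def kernel'_neg_def kernel'_plus_eq kernel'_minus_eq
        kernel'_eq_branch' kernel'_uminus)
  with \<theta> assms(1) show ?thesis
    by (simp add: p vec_field_def smooth_field_def kernel'_zero_eq kernel_0 kernel_eq_branch kernel_uminus)
qed

definition jac_RR :: "real \<Rightarrow> real \<Rightarrow> real \<Rightarrow> real" where
  "jac_RR \<beta> R \<theta> = 4 * (mean_slope \<beta> - branch' \<beta> (2 * pi - \<theta>)) * R + 2 * (branch' \<beta> \<theta> - mean_slope \<beta>)"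

definition jac_R\<theta> :: "real \<Rightarrow> real \<Rightarrow> real \<Rightarrow> real" where
  "jac_R\<theta> \<beta> R \<theta> = 2 * branch'' \<beta> (2 * pi - \<theta>) * R ^ 2 + 2 * branch'' \<beta> \<theta> * R"

definition jac_\<theta>R :: "real \<Rightarrow> real \<Rightarrow> real \<Rightarrow> real" where
  "jac_\<theta>R \<beta> R \<theta> = 2 * (branch \<beta> 0 - branch \<beta> (2 * pi - \<theta>))"

definition jac_\<theta>\<theta> :: "real \<Rightarrow> real \<Rightarrow> real \<Rightarrow> real" where
  "jac_\<theta>\<theta> \<beta> R \<theta> = 2 * branch' \<beta> (2 * pi - \<theta>) * R + 2 * branch' \<beta> \<theta>"

text \<open>The reflection \<open>\<theta> \<mapsto> 2\<pi> - \<theta>\<close> contributes a sign on differentiation, which cancels the minus signs in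
  front of the reflected terms; hence only plus signs in the column of derivatives in \<open>\<theta>\<close>.\<close>

lemma has_derivative_smooth_field:
  "(smooth_field \<beta> has_derivative
      (\<lambda>h. (jac_RR \<beta> R \<theta> * fst h + jac_R\<theta> \<beta> R \<theta> * snd h,
            jac_\<theta>R \<beta> R \<theta> * fst h + jac_\<theta>\<theta> \<beta> R \<theta> * snd h))) (at (R, \<theta>))"
proof -
  have comp: "((\<lambda>p. f (g p)) has_derivative (\<lambda>h. f' (g x) * g' h)) (at x)"
    if "\<And>t. (f has_real_derivative f' t) (at t)" "(g has_derivative g') (at x)"
    for f f' :: "real \<Rightarrow> real" and g g' :: "real \<times> real \<Rightarrow> real" and x
    using has_derivative_compose[OF that(2), of f "(*) (f' (g x))"] that(1)
    by (simp add: has_field_derivative_def)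
  note [derivative_intros] = comp[OF has_real_derivative_branch] comp[OF has_real_derivative_branch']
  have "smooth_field \<beta> = (\<lambda>p.
     (2 * (mean_slope \<beta> - branch' \<beta> (2 * pi - snd p)) * (fst p * fst p)
        + 2 * (branch' \<beta> (snd p) - mean_slope \<beta>) * fst p,
      2 * (branch \<beta> 0 - branch \<beta> (2 * pi - snd p)) * fst p + 2 * (branch \<beta> (snd p) - branch \<beta> 0)))"
    by (auto simp: smooth_field_def power2_eq_square)
  then show ?thesis
    unfolding jac_RR_def jac_R\<theta>_def jac_\<theta>R_def jac_\<theta>\<theta>_def
    by (auto intro!: derivative_eq_intros simp: algebra_simps power2_eq_square)
qed

definition jac :: "real \<Rightarrow> real \<Rightarrow> real \<Rightarrow> real mat" where
  "jac \<beta> R \<theta> = mat 2 2 (\<lambda>(i, j).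
     if i = 0 then (if j = 0 then jac_RR \<beta> R \<theta> else jac_R\<theta> \<beta> R \<theta>)
     else (if j = 0 then jac_\<theta>R \<beta> R \<theta> else jac_\<theta>\<theta> \<beta> R \<theta>))"

lemma jacobian_at_jac:
  assumes "\<beta> > 0" "(R, \<theta>) \<in> phase_space"
  shows "jacobian_at \<beta> (R, \<theta>) (jac \<beta> R \<theta>)"
proof -
  have "(smooth_field \<beta> has_derivative
      (\<lambda>h. (jac_RR \<beta> R \<theta> * fst h + jac_R\<theta> \<beta> R \<theta> * snd h,
            jac_\<theta>R \<beta> R \<theta> * fst h + jac_\<theta>\<theta> \<beta> R \<theta> * snd h))) (at (R, \<theta>) within phase_space)"
    by (rule has_derivative_at_withinI[OF has_derivative_smooth_field])
  then have "(vec_field \<beta> has_derivative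
      (\<lambda>h. (jac_RR \<beta> R \<theta> * fst h + jac_R\<theta> \<beta> R \<theta> * snd h,
            jac_\<theta>R \<beta> R \<theta> * fst h + jac_\<theta>\<theta> \<beta> R \<theta> * snd h))) (at (R, \<theta>) within phase_space)"
    by (rule has_derivative_transform[rotated 2])
      (use assms in \<open>auto simp: vec_field_eq_smooth_field\<close>)
  then show ?thesis
    by (simp add: jacobian_at_def jac_def)
qed

definition jac_det :: "real \<Rightarrow> real \<Rightarrow> real \<Rightarrow> real" where
  "jac_det \<beta> R \<theta> = jac_RR \<beta> R \<theta> * jac_\<theta>\<theta> \<beta> R \<theta> - jac_R\<theta> \<beta> R \<theta> * jac_\<theta>R \<beta> R \<theta>"

definition jac_trace :: "real \<Rightarrow> real \<Rightarrow> real \<Rightarrow> real" where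
  "jac_trace \<beta> R \<theta> = jac_RR \<beta> R \<theta> + jac_\<theta>\<theta> \<beta> R \<theta>"

lemma spectrum_jac:
  "spectrum (map_mat complex_of_real (jac \<beta> R \<theta>)) =
    {z. z\<^sup>2 - complex_of_real (jac_trace \<beta> R \<theta>) * z + complex_of_real (jac_det \<beta> R \<theta>) = 0}"
proof -
  have "jac \<beta> R \<theta> \<in> carrier_mat 2 2"
    by (simp add: jac_def)
  from spectrum_2x2[OF this] show ?thesis
    by (simp add: jac_def jac_trace_def jac_det_def)
qed

lemma equilibrium_iff:
  assumes "\<beta> > 0"
  shows "equilibrium \<beta> p \<longleftrightarrow> p \<in> phase_space \<and> smooth_field \<beta> p = (0, 0)"
  unfolding equilibrium_def using vec_field_eq_smooth_field[OF assms, of p] by auto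

lemma
  assumes "\<beta> > 0" and eq: "equilibrium \<beta> (R, \<theta>)"
  shows attractorI: "jac_det \<beta> R \<theta> > 0 \<Longrightarrow> jac_trace \<beta> R \<theta> < 0 \<Longrightarrow> attractor \<beta> (R, \<theta>)"
    and repellerI: "jac_det \<beta> R \<theta> > 0 \<Longrightarrow> jac_trace \<beta> R \<theta> > 0 \<Longrightarrow> repeller \<beta> (R, \<theta>)"
    and saddleI: "jac_det \<beta> R \<theta> < 0 \<Longrightarrow> saddle \<beta> (R, \<theta>)"
proof -
  have J: "jacobian_at \<beta> (R, \<theta>) (jac \<beta> R \<theta>)"
    using assms by (intro jacobian_at_jac) (auto simp: equilibrium_def)
  show "attractor \<beta> (R, \<theta>)" if "jac_det \<beta> R \<theta> > 0" "jac_trace \<beta> R \<theta> < 0"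
    unfolding attractor_def using eq J that complex_quadratic_root_Re(1)
    by (auto simp: spectrum_jac intro!: exI[of _ "jac \<beta> R \<theta>"])
  show "repeller \<beta> (R, \<theta>)" if "jac_det \<beta> R \<theta> > 0" "jac_trace \<beta> R \<theta> > 0"
    unfolding repeller_def using eq J that complex_quadratic_root_Re(2)
    by (auto simp: spectrum_jac intro!: exI[of _ "jac \<beta> R \<theta>"])
  show "saddle \<beta> (R, \<theta>)" if neg: "jac_det \<beta> R \<theta> < 0"
  proof -
    obtain p q where "p < 0" "0 < q"
      "spectrum (map_mat complex_of_real (jac \<beta> R \<theta>)) = {complex_of_real p, complex_of_real q}"
      using complex_quadratic_roots_real[OF neg, of "jac_trace \<beta> R \<theta>"] unfolding spectrum_jac
      by blast
    with eq J show ?thesis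
      unfolding saddle_def by blast
  qed
qed

section \<open>Slopes at the level points\<close>

lemma sin_cos_coeff_nonzero: "\<not> (cos_coeff \<beta> = 0 \<and> sin_coeff \<beta> = 0)" if "\<beta> > 0"
proof
  assume "cos_coeff \<beta> = 0 \<and> sin_coeff \<beta> = 0"
  then have "sin (2 * pi * freq \<beta>) = 0" and c: "cos (2 * pi * freq \<beta>) = exp (- (2 * pi * rate \<beta>))"
    using norm_const_pos[OF that] by (simp_all add: cos_coeff_def sin_coeff_def)
  then have "(exp (- (2 * pi * rate \<beta>)))\<^sup>2 = 1"
    using sin_cos_squared_add[of "2 * pi * freq \<beta>"] by simp
  moreover have "(exp (- (2 * pi * rate \<beta>)))\<^sup>2 < 1"
    using rate_pos[OF that] by (intro power_less_one_iff[THEN iffD2]) auto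
  ultimately show False
    by simp
qed

text \<open>Seen from a critical point \<open>\<theta>\<close>, the branch at \<open>0\<close> equals
  \<open>g \<theta> e\<^sup>-\<^sup>\<beta>\<^sup>w (cos w + \<beta> sin w)\<close> with \<open>w = b \<theta>\<close>. Since \<open>cos w + \<beta> sin w \<le> 1 + \<beta> w < e\<^sup>\<beta>\<^sup>w\<close>, the factor of
  \<open>g \<theta>\<close> is below \<open>1\<close>, so \<open>g 0 = g \<theta>\<close> forces \<open>g \<theta> = 0\<close>; together with \<open>g' \<theta> = 0\<close> the whole
  oscillation would vanish. Hence the level of \<open>g 0\<close> is always crossed transversally.\<close>

lemma branch'_nonzero_at_level_point:
  assumes \<beta>: "\<beta> > 0" and \<theta>: "\<theta> > 0" and eq: "branch \<beta> \<theta> = branch \<beta> 0"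
  shows "branch' \<beta> \<theta> \<noteq> 0"
proof
  assume zero: "branch' \<beta> \<theta> = 0"
  define w where "w = freq \<beta> * \<theta>"
  define P Q where "P = cos_coeff \<beta>" and "Q = sin_coeff \<beta>"
  \<comment> \<open>The pair \<open>(V, W)\<close> is \<open>(P, Q)\<close> rotated by the phase \<open>w\<close>, so \<open>V\<close> is the value of the oscillation
    at \<open>\<theta>\<close> freed from the exponential factor.\<close>
  define V W where "V = P * cos w + Q * sin w" and "W = Q * cos w - P * sin w"
  have w0: "w > 0"
    using \<theta> freq_pos by (simp add: w_def)
  have "branch' \<beta> \<theta> = exp (rate \<beta> * \<theta>) * (freq \<beta> * (\<beta> * V + W))"
    by (simp add: branch'_def V_def W_def w_def P_def Q_def rate_eq algebra_simps)
  then have W: "W = - \<beta> * V"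
    using zero freq_pos[of \<beta>] by simp
  have one: "sin w * sin w + cos w * cos w = 1"
    using sin_cos_squared_add[of w] by (simp add: power2_eq_square)
  have "c * (P * c + Q * s) - s * (Q * c - P * s) = P * (s * s + c * c)"
    "s * (P * c + Q * s) + c * (Q * c - P * s) = Q * (s * s + c * c)" for c s
    by (simp_all add: algebra_simps)
  from this[where c = "cos w" and s = "sin w"]
  have P: "P = cos w * V - sin w * W" and Q: "Q = sin w * V + cos w * W"
    unfolding V_def W_def one by (simp_all only: mult_1_right)
  have "exp (\<beta> * w) * V = P"
    using eq by (simp add: branch_def w_def V_def P_def Q_def rate_eq mult.assoc)
  then have "(exp (\<beta> * w) - cos w - \<beta> * sin w) * V = 0"
    using P unfolding W by (simp add: algebra_simps)
  moreover have "exp (\<beta> * w) > cos w + \<beta> * sin w"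
  proof -
    have "\<beta> * w > 0"
      using \<beta> w0 by simp
    then have "exp (\<beta> * w) > 1 + \<beta> * w"
      using exp_minus_greater[of "- (\<beta> * w)"] by auto
    moreover have "\<beta> * sin w \<le> \<beta> * w"
      using \<beta> w0 by (intro mult_left_mono sin_x_le_x) auto
    ultimately show ?thesis
      using cos_le_one[of w] by linarith
  qed
  ultimately have "V = 0"
    by simp
  then have "P = 0" "Q = 0"
    using P Q W by simp_all
  then show False
    using sin_cos_coeff_nonzero[OF \<beta>] by (simp add: P_def Q_def)
qed

lemma consecutive_zeros_pos_slope:
  fixes f :: "real \<Rightarrow> real"
  assumes "x < y" "f x = 0" "f y = 0"
    and p: "(f has_real_derivative p) (at x)" and q: "(f has_real_derivative q) (at y)"
    and cont: "continuous_on {x..y} f"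
    and nz: "\<And>t. x < t \<Longrightarrow> t < y \<Longrightarrow> f t \<noteq> 0"
    and "p > 0"
  shows "q \<le> 0"
proof (rule ccontr)
  assume "\<not> q \<le> 0"
  then obtain e where e: "e > 0" "\<And>h. 0 < h \<Longrightarrow> h < e \<Longrightarrow> f (y - h) < 0"
    using DERIV_pos_inc_left[OF q] assms by auto
  obtain d where d: "d > 0" "\<And>h. 0 < h \<Longrightarrow> h < d \<Longrightarrow> f (x + h) > 0"
    using DERIV_pos_inc_right[OF p] assms by auto
  define h where "h = min (min d e) (y - x) / 3"
  have "3 * h > 0" "3 * h \<le> d" "3 * h \<le> e" "3 * h \<le> y - x"
    using d(1) e(1) \<open>x < y\<close> by (simp_all add: h_def)
  then have h: "h > 0" "h < d" "h < e" "x + h < y - h"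
    by linarith+
  have "\<exists>t\<ge>x + h. t \<le> y - h \<and> f t = 0"
    using h d(2)[of h] e(2)[of h] by (intro IVT2' continuous_on_subset[OF cont]) auto
  then show False
    using nz h by force
qed

text \<open>Between consecutive zeros \<open>f\<close> keeps its sign, so it cannot leave the first and reach the second with
  slopes of the same sign.\<close>

lemma consecutive_zeros_slopes:
  fixes f :: "real \<Rightarrow> real"
  assumes "x < y" "f x = 0" "f y = 0"
    and p: "(f has_real_derivative p) (at x)" and q: "(f has_real_derivative q) (at y)"
    and cont: "continuous_on {x..y} f"
    and nz: "\<And>t. x < t \<Longrightarrow> t < y \<Longrightarrow> f t \<noteq> 0"
  shows "p * q \<le> 0"
proof -
  have "q \<le> 0" if "p > 0"
    using consecutive_zeros_pos_slope[of x y f p q] assms that by blast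
  moreover have "- q \<le> 0" if "- p > 0"
    using that assms
    by (intro consecutive_zeros_pos_slope[of x y "\<lambda>t. - f t" "- p" "- q"])
      (auto intro!: DERIV_minus continuous_on_minus)
  ultimately show ?thesis
    by (cases "p > 0"; cases "p = 0") (auto intro: mult_nonneg_nonpos mult_nonpos_nonneg)
qed

lemma level_set_eq:
  "\<beta> > 0 \<Longrightarrow> level_set \<beta> = {\<theta>. 0 < \<theta> \<and> \<theta> < 2 * pi \<and> branch \<beta> \<theta> = branch \<beta> 0}"
  by (auto simp: level_set_def kernel_0 kernel_eq_branch)

lemma level_slopes_alternate:
  assumes \<beta>: "\<beta> > 0" and "x < y" and x: "x \<in> insert 0 (level_set \<beta>)"
    and y: "y \<in> insert (2 * pi) (level_set \<beta>)" and no: "level_set \<beta> \<inter> {x<..<y} = {}"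
  shows "branch' \<beta> x * branch' \<beta> y \<le> 0"
proof (rule consecutive_zeros_slopes[where f = "\<lambda>t. branch \<beta> t - branch \<beta> 0"])
  have xy: "0 \<le> x" "y \<le> 2 * pi"
    using x y by (auto simp: level_set_eq[OF \<beta>])
  show "branch \<beta> x - branch \<beta> 0 = 0" "branch \<beta> y - branch \<beta> 0 = 0"
    using x y by (auto simp: level_set_eq[OF \<beta>] branch_endpoints)
  show "branch \<beta> t - branch \<beta> 0 \<noteq> 0" if "x < t" "t < y" for t
  proof -
    have "t \<notin> level_set \<beta>"
      using no that by auto
    then show ?thesis
      using that xy by (auto simp: level_set_eq[OF \<beta>])
  qed
  show "continuous_on {x..y} (\<lambda>t. branch \<beta> t - branch \<beta> 0)"
    by (intro continuous_intros
        DERIV_continuous_on[OF has_field_derivative_at_within[OF has_real_derivative_branch]])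
  show "((\<lambda>t. branch \<beta> t - branch \<beta> 0) has_real_derivative branch' \<beta> x) (at x)"
    "((\<lambda>t. branch \<beta> t - branch \<beta> 0) has_real_derivative branch' \<beta> y) (at y)"
    by (auto intro!: derivative_eq_intros has_real_derivative_branch)
qed fact

lemma branch'_2pi_neg: "\<beta> > 0 \<Longrightarrow> branch' \<beta> (2 * pi) < 0"
  using branch'_jump(2)[of \<beta>] mean_slope_neg[of \<beta>] freq_pos[of \<beta>] by simp

text \<open>Alternation, read from right to left: the slope at \<open>2\<pi>\<close> is negative, and at interior level points the
  slope is nonzero. At \<open>0\<close> the slope may vanish, hence the weak inequalities there.\<close>

lemma
  assumes "\<beta> > 0"
  shows last_level_slope: "\<And>x. level_set \<beta> \<inter> {x<..<2 * pi} = {} \<Longrightarrow> x \<in> level_set \<beta> \<Longrightarrow> branch' \<beta> x > 0"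
    and level_slope_before_pos: "\<And>x y. x < y \<Longrightarrow> level_set \<beta> \<inter> {x<..<y} = {} \<Longrightarrow> x \<in> level_set \<beta> \<Longrightarrow>
        y \<in> level_set \<beta> \<Longrightarrow> branch' \<beta> y > 0 \<Longrightarrow> branch' \<beta> x < 0"
    and level_slope_before_neg: "\<And>x y. x < y \<Longrightarrow> level_set \<beta> \<inter> {x<..<y} = {} \<Longrightarrow> x \<in> level_set \<beta> \<Longrightarrow>
        y \<in> level_set \<beta> \<Longrightarrow> branch' \<beta> y < 0 \<Longrightarrow> branch' \<beta> x > 0"
    and initial_slope_before_pos: "\<And>y. level_set \<beta> \<inter> {0<..<y} = {} \<Longrightarrow>
        y \<in> level_set \<beta> \<Longrightarrow> branch' \<beta> y > 0 \<Longrightarrow> branch' \<beta> 0 \<le> 0"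
    and initial_slope_before_neg: "\<And>y. level_set \<beta> \<inter> {0<..<y} = {} \<Longrightarrow>
        y \<in> level_set \<beta> \<Longrightarrow> branch' \<beta> y < 0 \<Longrightarrow> branch' \<beta> 0 \<ge> 0"
    and initial_slope_no_level: "level_set \<beta> = {} \<Longrightarrow> branch' \<beta> 0 \<ge> 0"
proof -
  have nz: "branch' \<beta> x \<noteq> 0" if "x \<in> level_set \<beta>" for x
    using branch'_nonzero_at_level_point[OF assms] that by (auto simp: level_set_eq[OF assms])
  show "branch' \<beta> x > 0" if "level_set \<beta> \<inter> {x<..<2 * pi} = {}" "x \<in> level_set \<beta>" for x
    using level_slopes_alternate[OF assms, of x "2 * pi"] that nz[of x] branch'_2pi_neg[OF assms]
    by (auto simp: level_set_eq[OF assms] mult_le_0_iff)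
  show "branch' \<beta> x < 0" if "x < y" "level_set \<beta> \<inter> {x<..<y} = {}" "x \<in> level_set \<beta>"
        "y \<in> level_set \<beta>" "branch' \<beta> y > 0" for x y
    using level_slopes_alternate[OF assms, of x y] that nz[of x] by (auto simp: mult_le_0_iff)
  show "branch' \<beta> x > 0" if "x < y" "level_set \<beta> \<inter> {x<..<y} = {}" "x \<in> level_set \<beta>"
        "y \<in> level_set \<beta>" "branch' \<beta> y < 0" for x y
    using level_slopes_alternate[OF assms, of x y] that nz[of x] by (auto simp: mult_le_0_iff)
  show "branch' \<beta> 0 \<le> 0" if "level_set \<beta> \<inter> {0<..<y} = {}" "y \<in> level_set \<beta>" "branch' \<beta> y > 0" for y
    using level_slopes_alternate[OF assms, of 0 y] that
    by (auto simp: level_set_eq[OF assms] mult_le_0_iff)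
  show "branch' \<beta> 0 \<ge> 0" if "level_set \<beta> \<inter> {0<..<y} = {}" "y \<in> level_set \<beta>" "branch' \<beta> y < 0" for y
    using level_slopes_alternate[OF assms, of 0 y] that
    by (auto simp: level_set_eq[OF assms] mult_le_0_iff)
  show "branch' \<beta> 0 \<ge> 0" if "level_set \<beta> = {}"
    using level_slopes_alternate[OF assms, of 0 "2 * pi"] that branch'_2pi_neg[OF assms]
    by (auto simp: mult_le_0_iff)
qed

section \<open>The initial slope as a function of the parameter\<close>

text \<open>The slope of the branch at \<open>0\<close> up to a positive factor; here \<open>y = 2 \<pi> b\<close> and \<open>\<beta> y = 2 \<pi> a\<close>.\<close>

definition slope_sign :: "real \<Rightarrow> real" where
  "slope_sign \<beta> = (let y = 4 * pi / (1 + \<beta>\<^sup>2) in exp (- (\<beta> * y)) + \<beta> * sin y - cos y)"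

text \<open>At a zero the derivative collapses to \<open>(1 - x) sin y - y cos y\<close> with \<open>x = \<beta> y\<close>, because
  \<open>e\<^sup>-\<^sup>x = cos y - \<beta> sin y\<close> and \<open>(1 + \<beta>\<^sup>2) y' = -2 x\<close>. If this vanished as well, the two equations would determine
  \<open>sin y\<close> and \<open>cos y\<close> in terms of \<open>x\<close> and \<open>e\<^sup>-\<^sup>x\<close>. For \<open>sin y \<ge> 0\<close> this contradicts \<open>sin y \<le> y\<close>. For
  \<open>sin y < 0\<close> it makes \<open>sin\<^sup>2 y + cos\<^sup>2 y\<close> too small when \<open>x \<ge> 2\<close>; when \<open>x < 2\<close>, the relation
  \<open>x\<^sup>2 = y (4\<pi> - y)\<close> forces \<open>y\<close> so close to \<open>4\<pi>\<close> that \<open>cos y\<close> is larger than the value prescribed for it.\<close>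

lemma slope_sign_simple_zero:
  assumes "\<beta> > 0" "slope_sign \<beta> = 0"
  obtains D where "(slope_sign has_real_derivative D) (at \<beta>)" "D \<noteq> 0"
proof -
  define y where "y = 4 * pi / (1 + \<beta>\<^sup>2)"
  define x where "x = \<beta> * y"
  define y' where "y' = - (8 * pi * \<beta> / (1 + \<beta>\<^sup>2)\<^sup>2)"
  have pos: "1 + \<beta>\<^sup>2 > 0"
    by (simp add: add_pos_nonneg)
  have y0: "y > 0"
    using pos by (simp add: y_def)
  have x0: "x > 0"
    using y0 assms by (simp add: x_def)
  have y_eq: "(1 + \<beta>\<^sup>2) * y = 4 * pi"
    using pos by (simp add: y_def)
  have y'_eq: "(1 + \<beta>\<^sup>2) * y' = - 2 * x"
  proof -
    have "n * - (8 * pi * \<beta> / n\<^sup>2) = - 2 * (\<beta> * (4 * pi / n))" if "n > 0" for n :: real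
      using that by (simp add: field_simps power2_eq_square)
    from this[OF pos] show ?thesis
      by (simp add: y'_def x_def y_def)
  qed
  have S0: "exp (- x) = cos y - \<beta> * sin y"
    using assms by (simp add: slope_sign_def x_def y_def Let_def)
  have dy: "((\<lambda>\<beta>. 4 * pi / (1 + \<beta>\<^sup>2)) has_real_derivative y') (at \<beta>)"
    unfolding y'_def using pos
    by (auto intro!: derivative_eq_intros simp: power2_eq_square)
  have D0: "(slope_sign has_real_derivative
      (exp (- x) * - (y + \<beta> * y') + (sin y + \<beta> * (cos y * y')) + sin y * y')) (at \<beta>)"
    unfolding slope_sign_def Let_def
    by (rule derivative_eq_intros dy refl)+ (simp add: x_def y_def algebra_simps)
  have E1: "exp (- x) * - (y + \<beta> * y') + (sin y + \<beta> * (cos y * y')) + sin y * y'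
      = - y * cos y + sin y * (1 + \<beta> * y + (1 + \<beta>\<^sup>2) * y')"
    unfolding S0 by (simp add: algebra_simps power2_eq_square)
  have E2: "1 + \<beta> * y + (1 + \<beta>\<^sup>2) * y' = 1 - x"
    unfolding y'_eq by (simp add: x_def)
  have D: "(slope_sign has_real_derivative ((1 - x) * sin y - y * cos y)) (at \<beta>)"
    using D0 unfolding E1 E2 by (simp add: mult.commute)
  have "(1 - x) * sin y - y * cos y \<noteq> 0"
  proof
    assume "(1 - x) * sin y - y * cos y = 0"
    then have c: "y * cos y = (1 - x) * sin y"
      by simp
    have e: "y * exp (- x) = (1 - 2 * x) * sin y"
    proof -
      have "y * exp (- x) = y * cos y - x * sin y"
        unfolding S0 by (simp add: algebra_simps x_def)
      then show ?thesis
        unfolding c by (simp add: algebra_simps)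
    qed
    have ey: "y * exp (- x) > 0"
      using y0 by simp
    have "sin y < 0"
    proof (rule ccontr)
      assume "\<not> sin y < 0"
      then have "sin y > 0"
        using e ey by (cases "sin y = 0") auto
      then have "1 - 2 * x > 0"
        using e ey by (simp add: zero_less_mult_iff)
      moreover have "sin y \<le> y"
        using y0 by (intro sin_x_le_x) simp
      ultimately have "y * exp (- x) \<le> (1 - 2 * x) * y"
        using e by (simp add: mult_left_mono)
      then have "exp (- x) \<le> 1 - 2 * x"
        using y0 by (simp add: mult.commute)
      moreover have "exp (- x) \<ge> 1 - x"
        using exp_ge_add_one_self[of "- x"] by simp
      ultimately show False
        using x0 by simp
    qed
    then have x1: "2 * x - 1 > 0"
      using e ey by (simp add: zero_less_mult_iff)
    have xy: "x\<^sup>2 = y * (4 * pi - y)"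
    proof -
      have "x\<^sup>2 + y * y = y * ((1 + \<beta>\<^sup>2) * y)"
        by (simp add: x_def power2_eq_square algebra_simps)
      then show ?thesis
        unfolding y_eq by (simp add: algebra_simps)
    qed
    have y4: "y < 4 * pi"
    proof -
      have "y * (4 * pi - y) > 0"
        using xy x0 by (metis zero_less_power)
      then show ?thesis
        using y0 by (simp add: zero_less_mult_iff)
    qed
    have "y > pi"
    proof (rule ccontr)
      assume "\<not> y > pi"
      then have "sin y \<ge> 0"
        using y0 by (intro sin_ge_zero) auto
      then show False
        using \<open>sin y < 0\<close> by simp
    qed
    have cy: "(2 * x - 1) * cos y = (x - 1) * exp (- x)"
    proof -
      have "y * ((2 * x - 1) * cos y) = (2 * x - 1) * ((1 - x) * sin y)"
        by (simp add: c[symmetric])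
      also have "\<dots> = (x - 1) * ((1 - 2 * x) * sin y)"
        by (simp add: algebra_simps)
      also have "\<dots> = y * ((x - 1) * exp (- x))"
        unfolding e[symmetric] by simp
      finally show ?thesis
        using y0 by simp
    qed
    have sy: "(2 * x - 1) * sin y = - (y * exp (- x))"
      unfolding e by (simp add: algebra_simps)
    \<comment> \<open>The identity \<open>sin\<^sup>2 y + cos\<^sup>2 y = 1\<close> with both prescribed values inserted.\<close>
    have key: "(2 * x - 1)\<^sup>2 = ((x - 1)\<^sup>2 + y\<^sup>2) * (exp (- x))\<^sup>2"
    proof -
      have "(2 * x - 1)\<^sup>2 = (2 * x - 1)\<^sup>2 * ((cos y)\<^sup>2 + (sin y)\<^sup>2)"
        by simp
      also have "\<dots> = ((2 * x - 1) * cos y)\<^sup>2 + ((2 * x - 1) * sin y)\<^sup>2"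
        by (simp only: power_mult_distrib distrib_left)
      also have "\<dots> = ((x - 1)\<^sup>2 + y\<^sup>2) * (exp (- x))\<^sup>2"
        unfolding cy sy by (simp only: power_mult_distrib power2_minus distrib_right)
      finally show ?thesis .
    qed
    have "x < 2"
    proof (rule ccontr)
      assume "\<not> x < 2"
      then have x2: "x \<ge> 2" by simp
      \<comment> \<open>The crude bounds \<open>e\<^sup>2 \<ge> 6\<close> and \<open>y < 13\<close> suffice.\<close>
      have "exp x \<ge> exp 2"
        using x2 by simp
      moreover have "exp (2::real) = exp 1 * exp 1"
        by (simp flip: exp_add)
      moreover have "exp (1::real) \<ge> 5 / 2"
        using exp_lower_Taylor_quadratic[of "1::real"] by simp
      then have "exp 1 * exp (1::real) \<ge> 5 / 2 * (5 / 2)"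
        by (intro mult_mono) auto
      ultimately have "exp x \<ge> 6" by simp
      then have "exp (- x) \<le> 1 / 6"
        by (simp add: exp_minus field_simps)
      then have "(exp (- x))\<^sup>2 \<le> (1 / 6)\<^sup>2"
        by (intro power_mono) auto
      then have "(2 * x - 1)\<^sup>2 \<le> ((x - 1)\<^sup>2 + y\<^sup>2) * (1 / 36)"
        unfolding key by (intro mult_left_mono) (auto simp: power2_eq_square)
      moreover have "y\<^sup>2 \<le> 13\<^sup>2"
        using y4 y0 pi_less_4 pi_approx by (intro power_mono) auto
      moreover have "36 * (2 * x - 1)\<^sup>2 > (x - 1)\<^sup>2 + 13\<^sup>2"
      proof -
        have "36 * (2 * x - 1)\<^sup>2 - (x - 1)\<^sup>2 - 169 = (x - 2) * (143 * x + 144) + 154"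
          by (simp add: algebra_simps power2_eq_square)
        moreover have "(x - 2) * (143 * x + 144) \<ge> 0"
          using x2 by simp
        ultimately show ?thesis by simp
      qed
      ultimately show False by simp
    qed
    define s where "s = 4 * pi - y"
    have s0: "s > 0"
      using y4 by (simp add: s_def)
    have ys: "y * s < 4"
      using xy \<open>x < 2\<close> x0 power_strict_mono[of x 2 2] by (simp add: s_def)
    have "s < 4 / 3"
    proof -
      have "3 * s \<le> y * s"
        using \<open>y > pi\<close> pi_gt3 s0 by (intro mult_right_mono) auto
      then show ?thesis using ys by simp
    qed
    then have "y > 10"
      using pi_gt3 by (simp add: s_def)
    have "s < 2 / 5"
    proof -
      have "10 * s \<le> y * s"
        using \<open>y > 10\<close> s0 by (intro mult_right_mono) auto
      then show ?thesis using ys by simp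
    qed
    have "cos y > 3 / 5"
    proof -
      have "cos y = cos s"
        using cos_periodic[of "- s"] cos_periodic[of "- s + 2 * pi"] cos_minus[of s] by (simp add: s_def)
      \<comment> \<open>In the first quadrant \<open>(sin s + cos s)\<^sup>2 \<ge> 1\<close>.\<close>
      moreover have "cos s \<ge> 1 - sin s"
      proof -
        have "sin s \<ge> 0" "cos s \<ge> 0"
          using s0 \<open>s < 2 / 5\<close> pi_gt3 by (auto intro: sin_ge_zero cos_ge_zero)
        then have "(sin s + cos s)\<^sup>2 \<ge> 1\<^sup>2"
          by (simp add: power2_sum)
        then show ?thesis
          using power2_le_imp_le[of 1 "sin s + cos s"] \<open>sin s \<ge> 0\<close> \<open>cos s \<ge> 0\<close> by simp
      qed
      moreover have "sin s \<le> s"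
        using s0 by (intro sin_x_le_x) simp
      ultimately show ?thesis
        using \<open>s < 2 / 5\<close> by simp
    qed
    then have "(2 * x - 1) * cos y > (2 * x - 1) * (3 / 5)"
      using x1 by (rule mult_strict_left_mono)
    moreover have "(x - 1) * exp (- x) \<le> (2 * x - 1) * (1 / 2)"
    proof (cases "x \<le> 1")
      case True
      then have "(x - 1) * exp (- x) \<le> 0"
        by (simp add: mult_nonpos_nonneg)
      then show ?thesis using x1 by simp
    next
      case False
      then have "(x - 1) * exp (- x) \<le> (x - 1) * 1"
        using x0 by (intro mult_left_mono) auto
      then show ?thesis by (simp add: algebra_simps)
    qed
    ultimately show False
      using cy x1 by simp
  qed
  with D show thesis by (rule that)
qed

lemma branch'_0_slope_sign:
  "branch' \<beta> 0 = freq \<beta> / norm_const \<beta> * slope_sign \<beta>"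
proof -
  have y: "4 * pi / (1 + \<beta>\<^sup>2) = 2 * pi * freq \<beta>"
    by (simp add: freq_def)
  show ?thesis
    unfolding branch'_0 slope_sign_def y Let_def
    by (simp add: rate_eq algebra_simps add_divide_distrib diff_divide_distrib)
qed

lemma branch'_0_sgn:
  assumes "\<beta> > 0"
  shows "sgn (branch' \<beta> 0) = sgn (slope_sign \<beta>)"
  unfolding branch'_0_slope_sign sgn_mult using freq_pos[of \<beta>] norm_const_pos[OF assms] by simp

text \<open>A simple zero is a change of sign.\<close>

lemma slope_sign_changes:
  assumes "open U" "\<beta> \<in> U" "\<beta> > 0" "slope_sign \<beta> = 0"
  obtains x y where "x \<in> U" "slope_sign x < 0" "y \<in> U" "slope_sign y > 0"
proof -
  obtain D where D: "(slope_sign has_real_derivative D) (at \<beta>)" "D \<noteq> 0"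
    using slope_sign_simple_zero[OF assms(3,4)] .
  obtain e where e: "e > 0" "ball \<beta> e \<subseteq> U"
    using assms by (meson openE)
  have *: "\<exists>x\<in>U. f x < 0" "\<exists>y\<in>U. f y > 0"
    if f: "(f has_real_derivative d) (at \<beta>)" and d: "d > 0" and f0: "f \<beta> = 0" for f d
  proof -
    obtain d1 where d1: "d1 > 0" "\<And>h. 0 < h \<Longrightarrow> h < d1 \<Longrightarrow> f (\<beta> - h) < 0"
      using DERIV_pos_inc_left[OF f d] f0 by auto
    obtain d2 where d2: "d2 > 0" "\<And>h. 0 < h \<Longrightarrow> h < d2 \<Longrightarrow> f (\<beta> + h) > 0"
      using DERIV_pos_inc_right[OF f d] f0 by auto
    define h where "h = min (min d1 d2) e / 2"
    have "2 * h > 0" "2 * h \<le> d1" "2 * h \<le> d2" "2 * h \<le> e"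
      using d1(1) d2(1) e(1) by (simp_all add: h_def)
    then have h: "h > 0" "h < d1" "h < d2" "h < e"
      by linarith+
    then have "\<beta> - h \<in> U" "\<beta> + h \<in> U"
      using e(2) by (auto simp: dist_real_def subset_iff)
    then show "\<exists>x\<in>U. f x < 0" "\<exists>y\<in>U. f y > 0"
      using d1(2)[of h] d2(2)[of h] h by auto
  qed
  show thesis
  proof (cases "D > 0")
    case True
    then show thesis
      using *[OF D(1) True assms(4)] that by blast
  next
    case False
    then have "- D > 0"
      using D(2) by simp
    then show thesis
      using *[OF DERIV_minus[OF D(1)]] assms(4) that by auto
  qed
qed

text \<open>On an open range of parameters a weak sign of the initial slope excludes its changes of sign, hence its
  zeros.\<close>

lemma initial_slope_strict_on_open:
  assumes "open U" "U \<subseteq> {0<..}" "\<beta> \<in> U"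
  shows "(\<And>x. x \<in> U \<Longrightarrow> branch' x 0 \<ge> 0) \<Longrightarrow> branch' \<beta> 0 > 0"
    and "(\<And>x. x \<in> U \<Longrightarrow> branch' x 0 \<le> 0) \<Longrightarrow> branch' \<beta> 0 < 0"
proof -
  have sg: "branch' x 0 < 0 \<longleftrightarrow> slope_sign x < 0" "branch' x 0 > 0 \<longleftrightarrow> slope_sign x > 0"
    if "x \<in> U" for x
    using branch'_0_sgn[of x] that assms(2) by (auto simp: sgn_if split: if_splits)
  have \<beta>: "\<beta> > 0"
    using assms by auto
  show "branch' \<beta> 0 > 0" if "\<And>x. x \<in> U \<Longrightarrow> branch' x 0 \<ge> 0"
  proof (rule ccontr)
    assume "\<not> branch' \<beta> 0 > 0"
    then have "slope_sign \<beta> = 0"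
      using that[OF assms(3)] sg[OF assms(3)] by linarith
    then obtain x where "x \<in> U" "slope_sign x < 0"
      using slope_sign_changes[OF assms(1,3) \<beta>] by metis
    then show False
      using that[of x] sg(1)[of x] by simp
  qed
  show "branch' \<beta> 0 < 0" if "\<And>x. x \<in> U \<Longrightarrow> branch' x 0 \<le> 0"
  proof (rule ccontr)
    assume "\<not> branch' \<beta> 0 < 0"
    then have "slope_sign \<beta> = 0"
      using that[OF assms(3)] sg[OF assms(3)] by linarith
    then obtain x where "x \<in> U" "slope_sign x > 0"
      using slope_sign_changes[OF assms(1,3) \<beta>] by metis
    then show False
      using that[of x] sg(2)[of x] by simp
  qed
qed

lemma level_anglesD:
  assumes "level_angles \<beta>\<^sub>0 \<beta>\<^sub>2 \<beta>\<^sub>3 \<theta>\<^sub>1 \<theta>\<^sub>2 \<theta>\<^sub>3"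
  shows "\<beta>\<^sub>0 < \<beta>\<^sub>2" "\<beta>\<^sub>2 < \<beta>\<^sub>3"
    and "\<beta> > 0 \<Longrightarrow> \<beta> < \<beta>\<^sub>0 \<Longrightarrow>
      \<theta>\<^sub>1 \<beta> < \<theta>\<^sub>2 \<beta> \<and> \<theta>\<^sub>2 \<beta> < \<theta>\<^sub>3 \<beta> \<and> level_set \<beta> = {\<theta>\<^sub>1 \<beta>, \<theta>\<^sub>2 \<beta>, \<theta>\<^sub>3 \<beta>}"
    and "\<beta>\<^sub>0 \<le> \<beta> \<Longrightarrow> \<beta> < \<beta>\<^sub>2 \<Longrightarrow> \<theta>\<^sub>2 \<beta> < \<theta>\<^sub>3 \<beta> \<and> level_set \<beta> = {\<theta>\<^sub>2 \<beta>, \<theta>\<^sub>3 \<beta>}"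
    and "\<beta>\<^sub>2 \<le> \<beta> \<Longrightarrow> \<beta> < \<beta>\<^sub>3 \<Longrightarrow> level_set \<beta> = {\<theta>\<^sub>3 \<beta>}"
    and "\<beta>\<^sub>3 \<le> \<beta> \<Longrightarrow> level_set \<beta> = {}"
  using assms by (simp_all add: level_angles_def)

text \<open>Counted from the right, the slopes at the level points are positive, negative, positive. The slope at
  \<open>0\<close> comes next in this alternation, so its weak sign depends on the parity of the number of level points.\<close>

lemma
  assumes angles: "level_angles \<beta>\<^sub>0 \<beta>\<^sub>2 \<beta>\<^sub>3 \<theta>\<^sub>1 \<theta>\<^sub>2 \<theta>\<^sub>3" and pos: "\<beta> > 0"
  shows slope_\<theta>\<^sub>3: "\<beta> < \<beta>\<^sub>3 \<Longrightarrow> \<theta>\<^sub>3 \<beta> \<in> level_set \<beta> \<and> branch' \<beta> (\<theta>\<^sub>3 \<beta>) > 0"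
    and slope_\<theta>\<^sub>2: "\<beta> < \<beta>\<^sub>2 \<Longrightarrow> \<theta>\<^sub>2 \<beta> \<in> level_set \<beta> \<and> branch' \<beta> (\<theta>\<^sub>2 \<beta>) < 0"
    and slope_\<theta>\<^sub>1: "\<beta> < \<beta>\<^sub>0 \<Longrightarrow> \<theta>\<^sub>1 \<beta> \<in> level_set \<beta> \<and> branch' \<beta> (\<theta>\<^sub>1 \<beta>) > 0"
    and initial_slope_weak:
      "\<beta> < \<beta>\<^sub>0 \<or> \<beta>\<^sub>2 \<le> \<beta> \<and> \<beta> < \<beta>\<^sub>3 \<Longrightarrow> branch' \<beta> 0 \<le> 0"
      "\<beta>\<^sub>0 \<le> \<beta> \<and> \<beta> < \<beta>\<^sub>2 \<or> \<beta>\<^sub>3 \<le> \<beta> \<Longrightarrow> branch' \<beta> 0 \<ge> 0"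
proof -
  note order = level_anglesD(1,2)[OF angles] and c3 = level_anglesD(3)[OF angles pos]
    and c2 = level_anglesD(4)[where \<beta> = \<beta>, OF angles] and c1 = level_anglesD(5)[OF angles]
    and c0 = level_anglesD(6)[where \<beta> = \<beta>, OF angles]
  have s3: "\<theta>\<^sub>3 \<beta> \<in> level_set \<beta> \<and> branch' \<beta> (\<theta>\<^sub>3 \<beta>) > 0" if "\<beta> < \<beta>\<^sub>3"
  proof -
    have "\<theta>\<^sub>3 \<beta> \<in> level_set \<beta>" "level_set \<beta> \<inter> {\<theta>\<^sub>3 \<beta><..<2 * pi} = {}"
      using c3 c2 c1 that order by (cases "\<beta> < \<beta>\<^sub>0"; cases "\<beta> < \<beta>\<^sub>2"; force)+
    then show ?thesis
      using last_level_slope[OF pos] by blast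
  qed
  have s2: "\<theta>\<^sub>2 \<beta> \<in> level_set \<beta> \<and> branch' \<beta> (\<theta>\<^sub>2 \<beta>) < 0" if "\<beta> < \<beta>\<^sub>2"
  proof -
    have "\<theta>\<^sub>2 \<beta> \<in> level_set \<beta>" "level_set \<beta> \<inter> {\<theta>\<^sub>2 \<beta><..<\<theta>\<^sub>3 \<beta>} = {}" "\<theta>\<^sub>2 \<beta> < \<theta>\<^sub>3 \<beta>"
      using c3 c2 that order by (cases "\<beta> < \<beta>\<^sub>0"; force)+
    then show ?thesis
      using level_slope_before_pos[OF pos, of "\<theta>\<^sub>2 \<beta>" "\<theta>\<^sub>3 \<beta>"] s3 that order by auto
  qed
  have s1: "\<theta>\<^sub>1 \<beta> \<in> level_set \<beta> \<and> branch' \<beta> (\<theta>\<^sub>1 \<beta>) > 0" if "\<beta> < \<beta>\<^sub>0"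
  proof -
    have "\<theta>\<^sub>1 \<beta> \<in> level_set \<beta>" "level_set \<beta> \<inter> {\<theta>\<^sub>1 \<beta><..<\<theta>\<^sub>2 \<beta>} = {}" "\<theta>\<^sub>1 \<beta> < \<theta>\<^sub>2 \<beta>"
      using c3 that by force+
    then show ?thesis
      using level_slope_before_neg[OF pos, of "\<theta>\<^sub>1 \<beta>" "\<theta>\<^sub>2 \<beta>"] s2 that order by auto
  qed
  show "\<beta> < \<beta>\<^sub>3 \<Longrightarrow> \<theta>\<^sub>3 \<beta> \<in> level_set \<beta> \<and> branch' \<beta> (\<theta>\<^sub>3 \<beta>) > 0"
    "\<beta> < \<beta>\<^sub>2 \<Longrightarrow> \<theta>\<^sub>2 \<beta> \<in> level_set \<beta> \<and> branch' \<beta> (\<theta>\<^sub>2 \<beta>) < 0"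
    "\<beta> < \<beta>\<^sub>0 \<Longrightarrow> \<theta>\<^sub>1 \<beta> \<in> level_set \<beta> \<and> branch' \<beta> (\<theta>\<^sub>1 \<beta>) > 0"
    by (fact s3 s2 s1)+
  show "branch' \<beta> 0 \<le> 0" if "\<beta> < \<beta>\<^sub>0 \<or> \<beta>\<^sub>2 \<le> \<beta> \<and> \<beta> < \<beta>\<^sub>3"
    using that
  proof
    assume a: "\<beta> < \<beta>\<^sub>0"
    have "level_set \<beta> \<inter> {0<..<\<theta>\<^sub>1 \<beta>} = {}"
      using c3[OF a] by force
    then show ?thesis
      using initial_slope_before_pos[OF pos] s1[OF a] by blast
  next
    assume a: "\<beta>\<^sub>2 \<le> \<beta> \<and> \<beta> < \<beta>\<^sub>3"
    then have "level_set \<beta> \<inter> {0<..<\<theta>\<^sub>3 \<beta>} = {}"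
      using c1 by force
    then show ?thesis
      using initial_slope_before_pos[OF pos] s3 a by blast
  qed
  show "branch' \<beta> 0 \<ge> 0" if "\<beta>\<^sub>0 \<le> \<beta> \<and> \<beta> < \<beta>\<^sub>2 \<or> \<beta>\<^sub>3 \<le> \<beta>"
    using that
  proof
    assume a: "\<beta>\<^sub>0 \<le> \<beta> \<and> \<beta> < \<beta>\<^sub>2"
    then have "level_set \<beta> \<inter> {0<..<\<theta>\<^sub>2 \<beta>} = {}"
      using c2 by force
    then show ?thesis
      using initial_slope_before_neg[OF pos] s2 a by blast
  qed (use initial_slope_no_level[OF pos] c0 in blast)
qed

lemma initial_slope_sign:
  assumes angles: "level_angles \<beta>\<^sub>0 \<beta>\<^sub>2 \<beta>\<^sub>3 \<theta>\<^sub>1 \<theta>\<^sub>2 \<theta>\<^sub>3"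
  shows "\<beta> \<in> {0<..<\<beta>\<^sub>0} \<union> {\<beta>\<^sub>2<..<\<beta>\<^sub>3} \<Longrightarrow> branch' \<beta> 0 < 0"
    and "\<beta> \<in> {\<beta>\<^sub>0<..<\<beta>\<^sub>2} \<union> {\<beta>\<^sub>3<..} \<Longrightarrow> branch' \<beta> 0 > 0"
proof -
  have order: "0 < \<beta>\<^sub>0" "\<beta>\<^sub>0 < \<beta>\<^sub>2" "\<beta>\<^sub>2 < \<beta>\<^sub>3"
    using angles by (auto simp: level_angles_def)
  note W = initial_slope_weak[OF angles]
  show "branch' \<beta> 0 < 0" if "\<beta> \<in> {0<..<\<beta>\<^sub>0} \<union> {\<beta>\<^sub>2<..<\<beta>\<^sub>3}"
    by (rule initial_slope_strict_on_open(2)[OF _ _ that]) (use order in \<open>auto intro!: W(1)\<close>)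
  show "branch' \<beta> 0 > 0" if "\<beta> \<in> {\<beta>\<^sub>0<..<\<beta>\<^sub>2} \<union> {\<beta>\<^sub>3<..}"
    by (rule initial_slope_strict_on_open(1)[OF _ _ that]) (use order in \<open>auto intro!: W(2)\<close>)
qed

section \<open>Equilibria and the elimination function\<close>

text \<open>The function \<open>F\<close> through the branch. It is the determinant that appears when \<open>R\<close> is eliminated from the two
  equilibrium equations, and the antisymmetry under \<open>\<theta> \<mapsto> 2\<pi> - \<theta>\<close> is visible in this form.\<close>

definition elim_fun :: "real \<Rightarrow> real \<Rightarrow> real" where
  "elim_fun \<beta> \<theta> =
     (branch' \<beta> \<theta> - mean_slope \<beta>) * (branch \<beta> (2 * pi - \<theta>) - branch \<beta> 0)
     - (branch' \<beta> (2 * pi - \<theta>) - mean_slope \<beta>) * (branch \<beta> \<theta> - branch \<beta> 0)"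

definition elim_fun' :: "real \<Rightarrow> real \<Rightarrow> real" where
  "elim_fun' \<beta> \<theta> =
     branch'' \<beta> \<theta> * (branch \<beta> (2 * pi - \<theta>) - branch \<beta> 0)
     - (branch' \<beta> \<theta> - mean_slope \<beta>) * branch' \<beta> (2 * pi - \<theta>)
     + branch'' \<beta> (2 * pi - \<theta>) * (branch \<beta> \<theta> - branch \<beta> 0)
     - (branch' \<beta> (2 * pi - \<theta>) - mean_slope \<beta>) * branch' \<beta> \<theta>"

lemma elim_fun'_reflect: "elim_fun' \<beta> (2 * pi - \<theta>) = elim_fun' \<beta> \<theta>"
  by (simp add: elim_fun'_def)

lemma has_real_derivative_elim_fun:
  "(elim_fun \<beta> has_real_derivative elim_fun' \<beta> \<theta>) (at \<theta>)"
proof -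
  note [derivative_intros] =
    DERIV_chain2[OF has_real_derivative_branch] DERIV_chain2[OF has_real_derivative_branch']
  show ?thesis
    unfolding elim_fun_def[abs_def] elim_fun'_def
    by (rule derivative_eq_intros refl)+ (simp add: algebra_simps)
qed

lemma F_fun_eq_elim_fun:
  assumes "\<beta> > 0" "0 < \<theta>" "\<theta> < 2 * pi"
  shows "F_fun \<beta> \<theta> = elim_fun \<beta> \<theta>"
  using assms
  by (simp add: F_fun_def elim_fun_def kernel_0 kernel_eq_branch kernel_uminus kernel'_eq_branch'
      kernel'_uminus kernel'_zero_eq algebra_simps)

lemma deriv_F_fun:
  assumes "\<beta> > 0" "0 < \<theta>" "\<theta> < 2 * pi"
  shows "deriv (F_fun \<beta>) \<theta> = elim_fun' \<beta> \<theta>"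
proof -
  have "(F_fun \<beta> has_real_derivative elim_fun' \<beta> \<theta>) (at \<theta>)"
    by (rule has_field_derivative_transform_within_open[OF has_real_derivative_elim_fun, of "{0<..<2 * pi}"])
      (use assms in \<open>auto simp: F_fun_eq_elim_fun\<close>)
  then show ?thesis
    by (rule DERIV_imp_deriv)
qed

text \<open>At an equilibrium the two relations express \<open>u = g' - m\<close> and \<open>k = g - g 0\<close> at \<open>\<theta>\<close> as \<open>R\<close> times their
  values at \<open>2\<pi> - \<theta>\<close>; with these substitutions both the determinant and the derivative of \<open>F\<close> become
  polynomials in \<open>R\<close>, and the former is \<open>4 R\<close> times the latter.\<close>

lemma jac_det_interior:
  assumes "branch' \<beta> \<theta> - mean_slope \<beta> = (branch' \<beta> (2 * pi - \<theta>) - mean_slope \<beta>) * R"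
    and "branch \<beta> \<theta> - branch \<beta> 0 = (branch \<beta> (2 * pi - \<theta>) - branch \<beta> 0) * R"
  shows "jac_det \<beta> R \<theta> = 4 * R * elim_fun' \<beta> \<theta>"
proof -
  define v where "v = branch' \<beta> (2 * pi - \<theta>) - mean_slope \<beta>"
  define l where "l = branch \<beta> (2 * pi - \<theta>) - branch \<beta> 0"
  have RR: "jac_RR \<beta> R \<theta> = - 2 * v * R"
    unfolding jac_RR_def assms(1) by (simp add: v_def algebra_simps)
  have \<theta>R: "jac_\<theta>R \<beta> R \<theta> = - 2 * l"
    by (simp add: jac_\<theta>R_def l_def)
  have elim: "elim_fun' \<beta> \<theta> = branch'' \<beta> \<theta> * l - v * R * branch' \<beta> (2 * pi - \<theta>)
      + branch'' \<beta> (2 * pi - \<theta>) * (l * R) - v * branch' \<beta> \<theta>"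
    unfolding elim_fun'_def assms by (simp add: v_def l_def)
  show ?thesis
    unfolding jac_det_def RR \<theta>R elim jac_R\<theta>_def jac_\<theta>\<theta>_def
    by (simp add: algebra_simps power2_eq_square)
qed

lemma interior_equilibrium_iff:
  assumes "\<beta> > 0" "0 < \<theta>" "\<theta> < 2 * pi" "R \<noteq> 0"
  shows "equilibrium \<beta> (R, \<theta>) \<longleftrightarrow>
    branch' \<beta> \<theta> - mean_slope \<beta> = (branch' \<beta> (2 * pi - \<theta>) - mean_slope \<beta>) * R \<and>
    branch \<beta> \<theta> - branch \<beta> 0 = (branch \<beta> (2 * pi - \<theta>) - branch \<beta> 0) * R"
proof -
  have R_eq: "2 * (m - v) * R ^ 2 + 2 * (u - m) * R = 0 \<longleftrightarrow> u - m = (v - m) * R" for u v m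
  proof -
    have "2 * (m - v) * R ^ 2 + 2 * (u - m) * R = 2 * R * ((u - m) - (v - m) * R)"
      by (simp add: algebra_simps power2_eq_square)
    then show ?thesis
      using assms(4) by simp
  qed
  have \<theta>_eq: "2 * (m - v) * R + 2 * (u - m) = 0 \<longleftrightarrow> u - m = (v - m) * R" for u v m
    by (auto simp: algebra_simps)
  have "(R, \<theta>) \<in> phase_space"
    using assms(2,3) by (simp add: phase_space_def)
  then show ?thesis
    unfolding equilibrium_iff[OF assms(1)]
    by (simp only: smooth_field_def prod.case prod.inject R_eq \<theta>_eq simp_thms)
qed

lemma axis_equilibrium_iff:
  assumes "\<beta> > 0"
  shows "equilibrium \<beta> (0, \<theta>) \<longleftrightarrow> \<theta> = 0 \<or> \<theta> = 2 * pi \<or> \<theta> \<in> level_set \<beta>"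
  unfolding equilibrium_iff[OF assms] level_set_eq[OF assms]
  by (auto simp: smooth_field_def phase_space_def branch_endpoints)

lemma boundary_equilibrium_iff:
  assumes \<beta>: "\<beta> > 0" and "\<theta> = 0 \<or> \<theta> = 2 * pi"
  shows "equilibrium \<beta> (R, \<theta>) \<longleftrightarrow> R = 0 \<or> R = - 1"
proof -
  have "smooth_field \<beta> (R, \<theta>) = ((if \<theta> = 0 then 1 else - 1) * (freq \<beta> / 2) * (R * (R + 1)), 0)"
    using assms(2)
    by (elim disjE)
      (simp_all add: smooth_field_def branch_endpoints branch'_jump[OF \<beta>],
        simp_all add: algebra_simps power2_eq_square)
  then show ?thesis
    unfolding equilibrium_iff[OF \<beta>] using assms(2) freq_pos[of \<beta>]
    by (auto simp: phase_space_def)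
qed

lemma jac_axis:
  "jac_det \<beta> 0 \<theta> = 4 * (branch' \<beta> \<theta> - mean_slope \<beta>) * branch' \<beta> \<theta>"
  "jac_trace \<beta> 0 \<theta> = 2 * (branch' \<beta> \<theta> - mean_slope \<beta>) + 2 * branch' \<beta> \<theta>"
  by (simp_all add: jac_det_def jac_trace_def jac_RR_def jac_R\<theta>_def jac_\<theta>\<theta>_def)

lemma axis_repellerI:
  assumes "\<beta> > 0" "equilibrium \<beta> (0, \<theta>)" "branch' \<beta> \<theta> > 0"
  shows "repeller \<beta> (0, \<theta>)"
  using assms mean_slope_neg[OF assms(1)]
  by (intro repellerI) (auto simp: jac_axis intro!: mult_pos_pos)

lemma axis_saddleI:
  assumes "\<beta> > 0" "equilibrium \<beta> (0, \<theta>)" "mean_slope \<beta> < branch' \<beta> \<theta>" "branch' \<beta> \<theta> < 0"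
  shows "saddle \<beta> (0, \<theta>)"
  using assms by (intro saddleI) (auto simp: jac_axis intro!: mult_pos_neg)

lemma saddle_boundary:
  assumes \<beta>: "\<beta> > 0" and "\<theta> = 0 \<or> \<theta> = 2 * pi"
  shows "saddle \<beta> (- 1, \<theta>)"
proof (rule saddleI[OF \<beta>])
  show "equilibrium \<beta> (- 1, \<theta>)"
    using boundary_equilibrium_iff[OF assms] by simp
  have "jac_det \<beta> (- 1) \<theta> = - (freq \<beta> / 2 * freq \<beta>)"
    using assms(2)
    by (auto simp: jac_det_def jac_RR_def jac_\<theta>R_def jac_\<theta>\<theta>_def branch_endpoints branch'_jump[OF \<beta>])
  then show "jac_det \<beta> (- 1) \<theta> < 0"
    using freq_pos[of \<beta>] by simp
qed

lemma attractor_0_2pi: "attractor \<beta> (0, 2 * pi)" if "\<beta> > 0"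
proof (rule attractorI[OF that])
  have *: "branch' \<beta> (2 * pi) - mean_slope \<beta> < 0" "branch' \<beta> (2 * pi) < 0"
    using branch'_2pi_neg[OF that] branch'_jump(2)[OF that] freq_pos[of \<beta>] by simp_all
  show "jac_det \<beta> 0 (2 * pi) > 0"
    unfolding jac_axis mult.assoc by (intro mult_pos_pos[of 4] mult_neg_neg *) simp
  show "jac_trace \<beta> 0 (2 * pi) < 0"
    unfolding jac_axis by (intro add_neg_neg mult_pos_neg *) simp_all
qed (simp add: axis_equilibrium_iff[OF that])

lemma A2_branch:
  assumes \<beta>: "\<beta> > 0" and A2: "assumption_A2"
  obtains \<alpha> where "pi < \<alpha>" "\<alpha> < 2 * pi" "\<And>\<theta>. 0 < \<theta> \<Longrightarrow> \<theta> < \<alpha> \<Longrightarrow> branch' \<beta> \<theta> > mean_slope \<beta>"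
    "branch' \<beta> \<alpha> = mean_slope \<beta>" "\<And>\<theta>. \<alpha> < \<theta> \<Longrightarrow> \<theta> < 2 * pi \<Longrightarrow> branch' \<beta> \<theta> < mean_slope \<beta>"
proof -
  obtain \<alpha> where \<alpha>: "A2_angle \<beta> \<alpha>"
    using A2 \<beta> unfolding assumption_A2_def by blast
  have b: "pi < \<alpha>" "\<alpha> < 2 * pi"
    using \<alpha> by (auto simp: A2_angle_def)
  have b0: "0 < \<alpha>"
    using b pi_gt_zero by linarith
  show thesis
  proof (rule that[of \<alpha>])
    show "branch' \<beta> \<theta> > mean_slope \<beta>" if "0 < \<theta>" "\<theta> < \<alpha>" for \<theta>
    proof -
      have "kernel' \<beta> \<theta> > kernel'_zero \<beta>"
        using \<alpha> that by (simp add: A2_angle_def)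
      then show ?thesis
        using that b by (simp add: kernel'_eq_branch'[OF \<beta>] kernel'_zero_eq[OF \<beta>])
    qed
    show "branch' \<beta> \<theta> < mean_slope \<beta>" if "\<alpha> < \<theta>" "\<theta> < 2 * pi" for \<theta>
    proof -
      have "kernel' \<beta> \<theta> < kernel'_zero \<beta>"
        using \<alpha> that by (simp add: A2_angle_def)
      then show ?thesis
        using that b0 by (simp add: kernel'_eq_branch'[OF \<beta>] kernel'_zero_eq[OF \<beta>])
    qed
    have "kernel' \<beta> \<alpha> = kernel'_zero \<beta>"
      using \<alpha> by (simp add: A2_angle_def)
    then show "branch' \<beta> \<alpha> = mean_slope \<beta>"
      using b b0 by (simp add: kernel'_eq_branch'[OF \<beta>] kernel'_zero_eq[OF \<beta>])
  qed (fact b)+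
qed

lemma branch_above_0_beyond_\<alpha>:
  assumes \<beta>: "\<beta> > 0" and "\<alpha> \<le> t" "t < 2 * pi"
    and below: "\<And>\<theta>. \<alpha> < \<theta> \<Longrightarrow> \<theta> < 2 * pi \<Longrightarrow> branch' \<beta> \<theta> < mean_slope \<beta>"
  shows "branch \<beta> t > branch \<beta> 0"
proof -
  have "branch \<beta> t > branch \<beta> (2 * pi)"
  proof (rule DERIV_neg_imp_decreasing_open[OF assms(3)])
    fix x assume "t < x" "x < 2 * pi"
    then have "\<alpha> < x"
      using assms(2) by simp
    from below[OF this \<open>x < 2 * pi\<close>] have "branch' \<beta> x < 0"
      using mean_slope_neg[OF \<beta>] by simp
    then show "\<exists>y. (branch \<beta> has_real_derivative y) (at x) \<and> y < 0"
      using has_real_derivative_branch by blast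
  next
    show "continuous_on {t..2 * pi} (branch \<beta>)"
      by (rule DERIV_continuous_on[OF has_field_derivative_at_within[OF has_real_derivative_branch]])
  qed
  then show ?thesis
    by (simp add: branch_endpoints)
qed

text \<open>Beyond \<open>\<alpha>\<close> the branch decreases to its value at \<open>2\<pi>\<close>, which is \<open>g 0\<close>; so every level point lies to
  the left of \<open>\<alpha>\<close>.\<close>

lemma level_point_slope_gt_mean:
  assumes \<beta>: "\<beta> > 0" and A2: "assumption_A2" and \<theta>: "\<theta> \<in> level_set \<beta>"
  shows "branch' \<beta> \<theta> > mean_slope \<beta>"
proof -
  obtain \<alpha> where \<alpha>: "\<And>\<theta>. 0 < \<theta> \<Longrightarrow> \<theta> < \<alpha> \<Longrightarrow> branch' \<beta> \<theta> > mean_slope \<beta>"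
    "\<And>\<theta>. \<alpha> < \<theta> \<Longrightarrow> \<theta> < 2 * pi \<Longrightarrow> branch' \<beta> \<theta> < mean_slope \<beta>"
    using A2_branch[OF \<beta> A2] by metis
  have "\<theta> < \<alpha>"
    using branch_above_0_beyond_\<alpha>[OF \<beta> _ _ \<alpha>(2), of \<theta>] \<theta>
    by (force simp: level_set_eq[OF \<beta>])
  then show ?thesis
    using \<alpha>(1) \<theta> by (auto simp: level_set_eq[OF \<beta>])
qed

text \<open>At \<open>2\<pi> - \<alpha>\<close> one of the two products in \<open>F\<close> vanishes and the other is positive, whereas \<open>F\<close> is negative just
  before \<open>\<pi>\<close>. The only zero in \<open>(0, \<pi>)\<close> therefore lies between \<open>2\<pi> - \<alpha>\<close> and \<open>\<pi>\<close>, and there the slope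
  exceeds the mean slope both at the zero and at its mirror image.\<close>

lemma slopes_gt_mean_at_elim_zero:
  assumes \<beta>: "\<beta> > 0" and A2: "assumption_A2"
    and zero: "\<And>\<theta>. 0 < \<theta> \<Longrightarrow> \<theta> < pi \<Longrightarrow> elim_fun \<beta> \<theta> = 0 \<longleftrightarrow> \<theta> = \<tau>"
    and slope: "elim_fun' \<beta> pi > 0"
  shows "branch' \<beta> \<tau> > mean_slope \<beta>" "branch' \<beta> (2 * pi - \<tau>) > mean_slope \<beta>"
proof -
  obtain \<alpha> where \<alpha>: "pi < \<alpha>" "\<alpha> < 2 * pi" "\<And>\<theta>. 0 < \<theta> \<Longrightarrow> \<theta> < \<alpha> \<Longrightarrow> branch' \<beta> \<theta> > mean_slope \<beta>"
    "branch' \<beta> \<alpha> = mean_slope \<beta>" "\<And>\<theta>. \<alpha> < \<theta> \<Longrightarrow> \<theta> < 2 * pi \<Longrightarrow> branch' \<beta> \<theta> < mean_slope \<beta>"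
    using A2_branch[OF \<beta> A2] by metis
  have "elim_fun \<beta> pi = 0"
    by (simp add: elim_fun_def)
  then obtain d where d: "d > 0" "\<And>h. 0 < h \<Longrightarrow> h < d \<Longrightarrow> elim_fun \<beta> (pi - h) < 0"
    using DERIV_pos_inc_left[OF has_real_derivative_elim_fun slope] by auto
  define h where "h = min d (\<alpha> - pi) / 2"
  have "2 * h > 0" "2 * h \<le> d" "2 * h \<le> \<alpha> - pi"
    using d(1) \<alpha>(1) by (simp_all add: h_def)
  then have h: "0 < h" "h < d" "h < \<alpha> - pi"
    by linarith+
  have "elim_fun \<beta> (2 * pi - \<alpha>) > 0"
    using \<alpha>(3)[of "2 * pi - \<alpha>"] \<alpha>(1,2,4) branch_above_0_beyond_\<alpha>[OF \<beta> order_refl \<alpha>(2,5)]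
    by (simp add: elim_fun_def)
  moreover have "elim_fun \<beta> (pi - h) < 0"
    using d(2) h by blast
  moreover have "continuous_on {2 * pi - \<alpha>..pi - h} (elim_fun \<beta>)"
    by (rule DERIV_continuous_on[OF has_field_derivative_at_within[OF has_real_derivative_elim_fun]])
  ultimately obtain x where x: "2 * pi - \<alpha> \<le> x" "x \<le> pi - h" "elim_fun \<beta> x = 0"
    using IVT2'[of "elim_fun \<beta>" "pi - h" 0 "2 * pi - \<alpha>"] h by auto
  moreover have "x \<noteq> 2 * pi - \<alpha>"
    using x(3) \<open>elim_fun \<beta> (2 * pi - \<alpha>) > 0\<close> by auto
  ultimately have "x = \<tau>" "2 * pi - \<alpha> < x" "x < pi"
    using zero[of x] h \<alpha>(2) by auto
  then show "branch' \<beta> \<tau> > mean_slope \<beta>" "branch' \<beta> (2 * pi - \<tau>) > mean_slope \<beta>"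
    using \<alpha>(1-3) by auto
qed

theorem theorem4p1:
  fixes \<beta>\<^sub>0 \<beta>\<^sub>1 \<beta>\<^sub>2 \<beta>\<^sub>3 \<beta>s \<beta> :: real
    and \<theta>\<^sub>1 \<theta>\<^sub>2 \<theta>\<^sub>3 \<theta>b :: "real \<Rightarrow> real"
  assumes angles: "level_angles \<beta>\<^sub>0 \<beta>\<^sub>2 \<beta>\<^sub>3 \<theta>\<^sub>1 \<theta>\<^sub>2 \<theta>\<^sub>3"
    and A1: "assumption_A1 \<beta>\<^sub>0 \<beta>\<^sub>1 \<beta>\<^sub>2 \<beta>\<^sub>3 \<theta>\<^sub>1 \<theta>\<^sub>2 \<theta>\<^sub>3"
    and A2: "assumption_A2"
    and A3: "assumption_A3 \<beta>\<^sub>1 \<beta>\<^sub>2 \<beta>s \<theta>b"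
    and A4: "assumption_A4 \<beta>\<^sub>1 \<beta>s \<theta>\<^sub>2 \<theta>b"
    and pos: "\<beta> > 0"
  shows
    "equilibrium \<beta> (1, pi) \<and>
     (\<beta> < \<beta>s \<longrightarrow> attractor \<beta> (1, pi)) \<and>
     (\<beta> > \<beta>s \<longrightarrow> saddle \<beta> (1, pi)) \<and>
     (\<beta> < \<beta>s \<longrightarrow> saddle \<beta> (R_ratio \<beta> (\<theta>b \<beta>), \<theta>b \<beta>) \<and>
        saddle \<beta> (1 / R_ratio \<beta> (\<theta>b \<beta>), 2 * pi - \<theta>b \<beta>)) \<and>
     attractor \<beta> (0, 2 * pi) \<and>
     (\<beta> < \<beta>\<^sub>3 \<longrightarrow> repeller \<beta> (0, \<theta>\<^sub>3 \<beta>)) \<and>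
     (\<beta> < \<beta>\<^sub>2 \<longrightarrow> saddle \<beta> (0, \<theta>\<^sub>2 \<beta>)) \<and>
     (\<beta> < \<beta>\<^sub>0 \<longrightarrow> repeller \<beta> (0, \<theta>\<^sub>1 \<beta>)) \<and>
     equilibrium \<beta> (0, 0) \<and>
     (\<beta> \<in> {0<..<\<beta>\<^sub>0} \<union> {\<beta>\<^sub>2<..<\<beta>\<^sub>3} \<longrightarrow> saddle \<beta> (0, 0)) \<and>
     (\<beta> \<in> {\<beta>\<^sub>0<..<\<beta>\<^sub>2} \<union> {\<beta>\<^sub>3<..} \<longrightarrow> repeller \<beta> (0, 0)) \<and>
     saddle \<beta> (-1, 0) \<and> saddle \<beta> (-1, 2 * pi) \<and>
     (\<beta> \<noteq> \<beta>s \<longrightarrow>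
        {p. equilibrium \<beta> p} =
          {(1, pi), (0, 2 * pi), (0, 0), (-1, 0), (-1, 2 * pi)}
          \<union> (if \<beta> < \<beta>s then {(R_ratio \<beta> (\<theta>b \<beta>), \<theta>b \<beta>), (1 / R_ratio \<beta> (\<theta>b \<beta>), 2 * pi - \<theta>b \<beta>)} else {})
          \<union> (if \<beta> < \<beta>\<^sub>3 then {(0, \<theta>\<^sub>3 \<beta>)} else {})
          \<union> (if \<beta> < \<beta>\<^sub>2 then {(0, \<theta>\<^sub>2 \<beta>)} else {})
          \<union> (if \<beta> < \<beta>\<^sub>0 then {(0, \<theta>\<^sub>1 \<beta>)} else {}))"
proof -
  define u where "u = (\<lambda>\<theta>. branch' \<beta> \<theta> - mean_slope \<beta>)"
  define k where "k = (\<lambda>\<theta>. branch \<beta> \<theta> - branch \<beta> 0)"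
  have elim: "elim_fun \<beta> \<theta> = u \<theta> * k (2 * pi - \<theta>) - u (2 * pi - \<theta>) * k \<theta>" for \<theta>
    by (simp add: elim_fun_def u_def k_def)
  have interior: "equilibrium \<beta> (R, \<theta>) \<longleftrightarrow> u \<theta> = u (2 * pi - \<theta>) * R \<and> k \<theta> = k (2 * pi - \<theta>) * R"
    if "0 < \<theta>" "\<theta> < 2 * pi" "R \<noteq> 0" for R \<theta>
    using interior_equilibrium_iff[OF pos that] by (simp add: u_def k_def)
  have det: "jac_det \<beta> R \<theta> = 4 * R * elim_fun' \<beta> \<theta>"
    if "u \<theta> = u (2 * pi - \<theta>) * R" "k \<theta> = k (2 * pi - \<theta>) * R" for R \<theta>
    using that by (intro jac_det_interior) (auto simp: u_def k_def)

  obtain \<alpha> where \<alpha>: "pi < \<alpha>" "\<And>\<theta>. 0 < \<theta> \<Longrightarrow> \<theta> < \<alpha> \<Longrightarrow> branch' \<beta> \<theta> > mean_slope \<beta>"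
    using A2_branch[OF pos A2] by metis
  have u_pi: "u pi > 0"
    using \<alpha> by (simp add: u_def)
  have eq_pi: "equilibrium \<beta> (1, pi)"
    by (simp add: interior)
  have det_pi: "jac_det \<beta> 1 pi = 4 * elim_fun' \<beta> pi"
    using det[of pi 1] by simp
  have tr_pi: "jac_trace \<beta> 1 pi < 0"
    using branch'_pi_plus_mean_slope_neg[OF pos]
    by (simp add: jac_trace_def jac_RR_def jac_\<theta>\<theta>_def)
  have slope_pi: "elim_fun' \<beta> pi > 0" if "\<beta> < \<beta>s"
  proof -
    have "deriv (F_fun \<beta>) pi > 0"
      using A3 pos that by (simp add: assumption_A3_def)
    then show ?thesis
      using deriv_F_fun[OF pos, of pi] by simp
  qed
  have attr_pi: "attractor \<beta> (1, pi)" if "\<beta> < \<beta>s"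
    using attractorI[OF pos eq_pi _ tr_pi] slope_pi[OF that] by (simp add: det_pi)
  have saddle_pi: "saddle \<beta> (1, pi)" if "\<beta> > \<beta>s"
  proof -
    have "deriv (F_fun \<beta>) pi < 0"
      using A3 that by (simp add: assumption_A3_def)
    then have "elim_fun' \<beta> pi < 0"
      using deriv_F_fun[OF pos, of pi] by simp
    then show ?thesis
      using saddleI[OF pos eq_pi] by (simp add: det_pi)
  qed

  define \<tau> where "\<tau> = \<theta>b \<beta>"
  define r where "r = R_ratio \<beta> \<tau>"
  have \<tau>: "0 < \<tau>" "\<tau> < pi" "\<And>\<theta>. 0 < \<theta> \<Longrightarrow> \<theta> < pi \<Longrightarrow> elim_fun \<beta> \<theta> = 0 \<longleftrightarrow> \<theta> = \<tau>"
      "elim_fun' \<beta> \<tau> < 0" "u \<tau> > 0" "u (2 * pi - \<tau>) > 0" "r = u \<tau> / u (2 * pi - \<tau>)"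
    if less: "\<beta> < \<beta>s"
  proof -
    have F: "\<forall>\<theta> \<in> {0<..<pi}. F_fun \<beta> \<theta> = 0 \<longleftrightarrow> \<theta> = \<tau>" and \<tau>': "\<tau> \<in> {0<..<pi}"
      and F': "deriv (F_fun \<beta>) \<tau> < 0"
      using A3 pos less by (auto simp: assumption_A3_def \<tau>_def)
    show 1: "0 < \<tau>" "\<tau> < pi"
      using \<tau>' by auto
    show 2: "elim_fun \<beta> \<theta> = 0 \<longleftrightarrow> \<theta> = \<tau>" if "0 < \<theta>" "\<theta> < pi" for \<theta>
      using F that F_fun_eq_elim_fun[OF pos, of \<theta>] by auto
    show "elim_fun' \<beta> \<tau> < 0"
      using F' 1 deriv_F_fun[OF pos, of \<tau>] by simp
    show "u \<tau> > 0" "u (2 * pi - \<tau>) > 0"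
      using slopes_gt_mean_at_elim_zero[OF pos A2 2 slope_pi[OF less]] by (simp_all add: u_def)
    show "r = u \<tau> / u (2 * pi - \<tau>)"
      using 1 by (simp add: r_def R_ratio_def u_def kernel'_zero_eq pos kernel'_eq_branch' kernel'_uminus)
  qed
  have saddles: "saddle \<beta> (r, \<tau>)" "saddle \<beta> (1 / r, 2 * pi - \<tau>)" if less: "\<beta> < \<beta>s"
  proof -
    note t = \<tau>[OF less]
    have r: "r > 0"
      using t by simp
    have 1: "u \<tau> = u (2 * pi - \<tau>) * r"
      using t by simp
    have "u \<tau> * k (2 * pi - \<tau>) = u (2 * pi - \<tau>) * k \<tau>"
      using t(3)[OF t(1,2)] by (simp add: elim)
    then have "u (2 * pi - \<tau>) * (k \<tau> - k (2 * pi - \<tau>) * r) = 0"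
      unfolding 1 by (auto simp: algebra_simps)
    then have 2: "k \<tau> = k (2 * pi - \<tau>) * r"
      using t(6) by simp
    show "saddle \<beta> (r, \<tau>)"
    proof (rule saddleI[OF pos])
      show "equilibrium \<beta> (r, \<tau>)"
        using interior[of \<tau> r] t(1,2) r 1 2 by simp
      show "jac_det \<beta> r \<tau> < 0"
        unfolding det[OF 1 2] using r t(4) by (simp add: mult_pos_neg)
    qed
    have 3: "u (2 * pi - \<tau>) = u (2 * pi - (2 * pi - \<tau>)) * (1 / r)"
        "k (2 * pi - \<tau>) = k (2 * pi - (2 * pi - \<tau>)) * (1 / r)"
      using 1 2 r by simp_all
    show "saddle \<beta> (1 / r, 2 * pi - \<tau>)"
    proof (rule saddleI[OF pos])
      show "equilibrium \<beta> (1 / r, 2 * pi - \<tau>)"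
        using interior[of "2 * pi - \<tau>" "1 / r"] t(1,2) r 3 by simp
      show "jac_det \<beta> (1 / r) (2 * pi - \<tau>) < 0"
        unfolding det[OF 3] elim_fun'_reflect using r t(4) by (simp add: mult_pos_neg divide_neg_pos)
    qed
  qed

  note axis = axis_equilibrium_iff[OF pos]
  note s3 = slope_\<theta>\<^sub>3[OF angles pos] and s2 = slope_\<theta>\<^sub>2[OF angles pos]
    and s1 = slope_\<theta>\<^sub>1[OF angles pos]
  have rep3: "repeller \<beta> (0, \<theta>\<^sub>3 \<beta>)" if "\<beta> < \<beta>\<^sub>3"
    using s3[OF that] by (intro axis_repellerI[OF pos]) (simp_all add: axis)
  have sad2: "saddle \<beta> (0, \<theta>\<^sub>2 \<beta>)" if "\<beta> < \<beta>\<^sub>2"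
    using s2[OF that] level_point_slope_gt_mean[OF pos A2]
    by (intro axis_saddleI[OF pos]) (simp_all add: axis)
  have rep1: "repeller \<beta> (0, \<theta>\<^sub>1 \<beta>)" if "\<beta> < \<beta>\<^sub>0"
    using s1[OF that] by (intro axis_repellerI[OF pos]) (simp_all add: axis)
  have eq0: "equilibrium \<beta> (0, 0)"
    by (simp add: axis)
  have sad0: "saddle \<beta> (0, 0)" if "\<beta> \<in> {0<..<\<beta>\<^sub>0} \<union> {\<beta>\<^sub>2<..<\<beta>\<^sub>3}"
    using initial_slope_sign(1)[OF angles that] branch'_jump(1)[OF pos] freq_pos[of \<beta>]
    by (intro axis_saddleI[OF pos eq0]) simp_all
  have rep0: "repeller \<beta> (0, 0)" if "\<beta> \<in> {\<beta>\<^sub>0<..<\<beta>\<^sub>2} \<union> {\<beta>\<^sub>3<..}"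
    using initial_slope_sign(2)[OF angles that] by (intro axis_repellerI[OF pos eq0])

  have level: "level_set \<beta> = (if \<beta> < \<beta>\<^sub>3 then {\<theta>\<^sub>3 \<beta>} else {}) \<union> (if \<beta> < \<beta>\<^sub>2 then {\<theta>\<^sub>2 \<beta>} else {})
      \<union> (if \<beta> < \<beta>\<^sub>0 then {\<theta>\<^sub>1 \<beta>} else {})"
  proof -
    note order = level_anglesD(1,2)[OF angles]
    consider "\<beta> < \<beta>\<^sub>0" | "\<beta>\<^sub>0 \<le> \<beta>" "\<beta> < \<beta>\<^sub>2" | "\<beta>\<^sub>2 \<le> \<beta>" "\<beta> < \<beta>\<^sub>3" | "\<beta>\<^sub>3 \<le> \<beta>"
      by linarith
    then show ?thesis
    proof cases
      case 1
      then show ?thesis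
        using order level_anglesD(3)[OF angles pos 1] by auto
    next
      case 2
      then show ?thesis
        using order level_anglesD(4)[OF angles 2] by auto
    next
      case 3
      then show ?thesis
        using order level_anglesD(5)[OF angles 3] by auto
    next
      case 4
      then show ?thesis
        using order level_anglesD(6)[OF angles 4] by auto
    qed
  qed

  define E where "E = {(1, pi), (0, 2 * pi), (0, 0), (-1, 0), (-1, 2 * pi)}
          \<union> (if \<beta> < \<beta>s then {(r, \<tau>), (1 / r, 2 * pi - \<tau>)} else {})
          \<union> (if \<beta> < \<beta>\<^sub>3 then {(0, \<theta>\<^sub>3 \<beta>)} else {})
          \<union> (if \<beta> < \<beta>\<^sub>2 then {(0, \<theta>\<^sub>2 \<beta>)} else {})
          \<union> (if \<beta> < \<beta>\<^sub>0 then {(0, \<theta>\<^sub>1 \<beta>)} else {})"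
  have "equilibrium \<beta> p \<longleftrightarrow> p \<in> E" if ne: "\<beta> \<noteq> \<beta>s" for p
  proof
    assume "p \<in> E"
    moreover have "equilibrium \<beta> (r, \<tau>)" "equilibrium \<beta> (1 / r, 2 * pi - \<tau>)" if "\<beta> < \<beta>s"
      using saddles[OF that] by (simp_all add: saddle_def)
    moreover have "equilibrium \<beta> (-1, 0)" "equilibrium \<beta> (-1, 2 * pi)"
      using boundary_equilibrium_iff[OF pos] by simp_all
    ultimately show "equilibrium \<beta> p"
      unfolding E_def using eq_pi axis s1 s2 s3 by (auto split: if_splits)
  next
    assume eq: "equilibrium \<beta> p"
    obtain R \<theta> where p: "p = (R, \<theta>)"
      by force
    have "\<theta> \<in> {0..2 * pi}"
      using eq by (simp add: p equilibrium_def phase_space_def)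
    then consider "\<theta> = 0 \<or> \<theta> = 2 * pi" | "R = 0" "\<theta> \<in> level_set \<beta>" | "R \<noteq> 0" "0 < \<theta>" "\<theta> < 2 * pi"
      using eq axis[of \<theta>] by (force simp: p)
    then show "p \<in> E"
    proof cases
      case 1
      then show ?thesis
        using eq boundary_equilibrium_iff[OF pos 1] by (auto simp: p E_def)
    next
      case 2
      then show ?thesis
        unfolding level by (auto simp: p E_def)
    next
      case 3
      have R: "u \<theta> = u (2 * pi - \<theta>) * R" "k \<theta> = k (2 * pi - \<theta>) * R"
        using eq interior[OF 3(2,3,1)] by (simp_all add: p)
      then have zero: "elim_fun \<beta> \<theta> = 0" "elim_fun \<beta> (2 * pi - \<theta>) = 0"
        by (simp_all add: elim)
      show ?thesis
      proof (cases "\<theta> = pi")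
        case True
        then show ?thesis
          using R(1) u_pi by (simp add: p E_def)
      next
        case False
        \<comment> \<open>By the antisymmetry of \<open>F\<close> the angle or its mirror image is a zero of \<open>F\<close> below \<open>\<pi>\<close>.\<close>
        then obtain t where t: "0 < t" "t < pi" "elim_fun \<beta> t = 0" "\<theta> = t \<or> \<theta> = 2 * pi - t"
          using 3(2,3) zero by (cases "\<theta> < pi") force+
        have less: "\<beta> < \<beta>s"
        proof (rule ccontr)
          assume "\<not> \<beta> < \<beta>s"
          then have "\<not> (\<exists>\<theta>\<in>{0<..<pi}. F_fun \<beta> \<theta> = 0)"
            using A3 ne by (auto simp: assumption_A3_def)
          then show False
            using t F_fun_eq_elim_fun[OF pos, of t] by auto
        qed
        note T = \<tau>[OF less]
        have "t = \<tau>"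
          using T(3)[OF t(1,2)] t(3) by simp
        show ?thesis
          using t(4)
        proof
          assume "\<theta> = t"
          then have "R = r"
            using R(1) T(6,7) \<open>t = \<tau>\<close> by simp
          then show ?thesis
            using less \<open>\<theta> = t\<close> \<open>t = \<tau>\<close> by (simp add: p E_def)
        next
          assume "\<theta> = 2 * pi - t"
          then have "R = 1 / r"
            using R(1) T(5,7) \<open>t = \<tau>\<close> by simp
          then show ?thesis
            using less \<open>\<theta> = 2 * pi - t\<close> \<open>t = \<tau>\<close> by (simp add: p E_def)
        qed
      qed
    qed
  qed
  then have "\<beta> \<noteq> \<beta>s \<longrightarrow> {p. equilibrium \<beta> p} = E"
    by blast
  with eq_pi attr_pi saddle_pi saddles attractor_0_2pi[OF pos] rep3 sad2 rep1 eq0 sad0 rep0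
    saddle_boundary[OF pos, of 0] saddle_boundary[OF pos, of "2 * pi"]
  show ?thesis
    unfolding E_def r_def \<tau>_def by blast
qed

end
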